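(* Let $R=\bigoplus_{\alpha\in\Gamma}R_{\alpha}$ be a graded integral domain and let $\star$ be a semistar operation on $R$ such that $R^{\star}\subsetneq R_H$. Then $R$ is a GP$\star$MD if and only if $(A_fA_g)^{\widetilde{\star}}=A_{fg}^{\widetilde{\star}}$ for all $f,g\in R_H[X]$.
   Context: $\Gamma$ is a commutative cancellative monoid (written additively) whose quotient group $\langle\Gamma\rangle$ is torsion-free. A graded integral domain $R=\bigoplus_{\alpha\in\Gamma}R_\alpha$ is an integral domain that is the direct sum of additive subgroups $R_\alpha$ with $R_\alpha R_\beta\subseteq R_{\alpha+\beta}$. $K$ is its quotient field, $H$ the set of nonzero homogeneous elements, $R_H$ (graded by $\langle\Gamma\rangle$) the homogeneous quotient field. For $a\in R_H$, $C(a)$ is the $R$-submodule of $R_H$ generated by the homogeneous components of $a$; for $f=f_0+\cdots+f_nX^n\in R_H[X]$, $A_f:=\sum_i C(f_i)$. A semistar operation on $R$ is a map $\star$ from the set of nonzero $R$-submodules of $K$ to itself such that for all $0\ne x\in K$ and $E,F$: $(xE)^\star=xE^\star$; $E\subseteq F\Rightarrow E^\star\subseteq F^\star$; $E\subseteq E^\star$; $(E^\star)^\star=E^\star$. $\star_f$: $E^{\star_f}=\bigcup\{F^\star: F\subseteq E$ nonzero finitely generated fractional ideal$\}$. $\widetilde\star$: $E^{\widetilde\star}=\{x\in K: xJ\subseteq E$ for some finitely generated ideal $J\subseteq R$ with $J^\star=R^\star\}$. A nonzero fractional ideal $I$ is $\star_f$-invertible if $(I(R:I))^{\star_f}=R^\star$.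 $R$ is a GP$\star$MD if every nonzero finitely generated homogeneous ideal of $R$ is $\star_f$-invertible. *)

theory Defs
  imports "HOL-Computational_Algebra.Polynomial"
begin

text \<open>Everything lives inside an ambient field 'k. R is a subring of 'k (hence an
integral domain) and its quotient field K is realised as the set frac R.
The grading monoid Gamma is a submonoid of an abelian group 'g; its quotient group
is then the subgroup {a - b} generated by Gamma.\<close>

definition rspan :: "'k::field set \<Rightarrow> 'k set \<Rightarrow> 'k set" where
  "rspan R S = {x. \<exists>F r. finite F \<and> F \<subseteq> S \<and> (\<forall>s\<in>F. r s \<in> R) \<and> x = (\<Sum>s\<in>F. r s * s)}"

definition frac :: "'k::field set \<Rightarrow> 'k set" where
  "frac R = {a / b | a b. a \<in> R \<and> b \<in> R \<and> b \<noteq> 0}"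

definition is_subring :: "'k::field set \<Rightarrow> bool" where
  "is_subring R \<longleftrightarrow> 0 \<in> R \<and> 1 \<in> R \<and>
     (\<forall>x\<in>R. \<forall>y\<in>R. x + y \<in> R \<and> x * y \<in> R \<and> - x \<in> R)"

definition quot_group :: "'g::ab_group_add set \<Rightarrow> 'g set" where
  "quot_group \<Gamma> = {a - b | a b. a \<in> \<Gamma> \<and> b \<in> \<Gamma>}"

definition graded_domain :: "'g::ab_group_add set \<Rightarrow> ('g \<Rightarrow> 'k::field set) \<Rightarrow> 'k set \<Rightarrow> bool" where
  "graded_domain \<Gamma> Rg R \<longleftrightarrow>
     0 \<in> \<Gamma> \<and> (\<forall>a\<in>\<Gamma>. \<forall>b\<in>\<Gamma>. a + b \<in> \<Gamma>) \<and>
     (\<forall>n::nat. \<forall>x\<in>quot_group \<Gamma>. n > 0 \<and> (\<Sum>i<n. x) = 0 \<longrightarrow> x = 0) \<and>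
     is_subring R \<and>
     (\<forall>\<alpha>\<in>\<Gamma>. Rg \<alpha> \<subseteq> R \<and> 0 \<in> Rg \<alpha> \<and> (\<forall>x\<in>Rg \<alpha>. \<forall>y\<in>Rg \<alpha>. x + y \<in> Rg \<alpha> \<and> - x \<in> Rg \<alpha>)) \<and>
     (\<forall>\<alpha>\<in>\<Gamma>. \<forall>\<beta>\<in>\<Gamma>. \<forall>x\<in>Rg \<alpha>. \<forall>y\<in>Rg \<beta>. x * y \<in> Rg (\<alpha> + \<beta>)) \<and>
     (\<forall>x\<in>R. \<exists>S c. finite S \<and> S \<subseteq> \<Gamma> \<and> (\<forall>\<alpha>\<in>S. c \<alpha> \<in> Rg \<alpha>) \<and> x = (\<Sum>\<alpha>\<in>S. c \<alpha>)) \<and>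
     (\<forall>S c. finite S \<and> S \<subseteq> \<Gamma> \<and> (\<forall>\<alpha>\<in>S. c \<alpha> \<in> Rg \<alpha>) \<and> (\<Sum>\<alpha>\<in>S. c \<alpha>) = 0
        \<longrightarrow> (\<forall>\<alpha>\<in>S. c \<alpha> = 0))"

definition homog :: "'g set \<Rightarrow> ('g \<Rightarrow> 'k::field set) \<Rightarrow> 'k set" where
  "homog \<Gamma> Rg = (\<Union>\<alpha>\<in>\<Gamma>. Rg \<alpha>) - {0}"

definition RH :: "'g set \<Rightarrow> ('g \<Rightarrow> 'k::field set) \<Rightarrow> 'k set \<Rightarrow> 'k set" where
  "RH \<Gamma> Rg R = {a / h | a h. a \<in> R \<and> h \<in> homog \<Gamma> Rg}"

definition RH_comp :: "'g::ab_group_add set \<Rightarrow> ('g \<Rightarrow> 'k::field set) \<Rightarrow> 'g \<Rightarrow> 'k set" where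
  "RH_comp \<Gamma> Rg \<delta> = {r / h | r h \<alpha> \<beta>. \<alpha> \<in> \<Gamma> \<and> \<beta> \<in> \<Gamma> \<and> r \<in> Rg \<alpha> \<and> h \<in> Rg \<beta> \<and> h \<noteq> 0 \<and> \<alpha> - \<beta> = \<delta>}"

definition hcomps :: "'g::ab_group_add set \<Rightarrow> ('g \<Rightarrow> 'k::field set) \<Rightarrow> 'k \<Rightarrow> 'g \<Rightarrow> 'k" where
  "hcomps \<Gamma> Rg a = (THE c. finite {\<delta>. c \<delta> \<noteq> 0} \<and> (\<forall>\<delta>. c \<delta> \<noteq> 0 \<longrightarrow> c \<delta> \<in> RH_comp \<Gamma> Rg \<delta>)
                          \<and> a = (\<Sum>\<delta>\<in>{\<delta>. c \<delta> \<noteq> 0}. c \<delta>))"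

definition compset :: "'g::ab_group_add set \<Rightarrow> ('g \<Rightarrow> 'k::field set) \<Rightarrow> 'k \<Rightarrow> 'k set" where
  "compset \<Gamma> Rg a = {hcomps \<Gamma> Rg a \<delta> | \<delta>. hcomps \<Gamma> Rg a \<delta> \<noteq> 0}"

definition Cont :: "'g::ab_group_add set \<Rightarrow> ('g \<Rightarrow> 'k::field set) \<Rightarrow> 'k set \<Rightarrow> 'k \<Rightarrow> 'k set" where
  "Cont \<Gamma> Rg R a = rspan R (compset \<Gamma> Rg a)"

definition Af :: "'g::ab_group_add set \<Rightarrow> ('g \<Rightarrow> 'k::field set) \<Rightarrow> 'k set \<Rightarrow> 'k poly \<Rightarrow> 'k set" where
  "Af \<Gamma> Rg R f = rspan R (\<Union>i. compset \<Gamma> Rg (coeff f i))"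

definition submod :: "'k::field set \<Rightarrow> 'k set \<Rightarrow> bool" where
  "submod R E \<longleftrightarrow> E \<subseteq> frac R \<and> 0 \<in> E \<and> (\<forall>x\<in>E. \<forall>y\<in>E. x + y \<in> E) \<and> (\<forall>r\<in>R. \<forall>x\<in>E. r * x \<in> E)"

definition nz_submod :: "'k::field set \<Rightarrow> 'k set \<Rightarrow> bool" where
  "nz_submod R E \<longleftrightarrow> submod R E \<and> E \<noteq> {0}"

definition smul :: "'k::field \<Rightarrow> 'k set \<Rightarrow> 'k set" where
  "smul x E = (\<lambda>y. x * y) ` E"

definition semistar :: "'k::field set \<Rightarrow> ('k set \<Rightarrow> 'k set) \<Rightarrow> bool" where
  "semistar R star \<longleftrightarrow>
     (\<forall>E. nz_submod R E \<longrightarrow> nz_submod R (star E)) \<and>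
     (\<forall>x\<in>frac R - {0}. \<forall>E. nz_submod R E \<longrightarrow> star (smul x E) = smul x (star E)) \<and>
     (\<forall>E F. nz_submod R E \<and> nz_submod R F \<and> E \<subseteq> F \<longrightarrow> star E \<subseteq> star F) \<and>
     (\<forall>E. nz_submod R E \<longrightarrow> E \<subseteq> star E) \<and>
     (\<forall>E. nz_submod R E \<longrightarrow> star (star E) = star E)"

definition fg_frac_ideal :: "'k::field set \<Rightarrow> 'k set \<Rightarrow> bool" where
  "fg_frac_ideal R F \<longleftrightarrow> (\<exists>G. finite G \<and> G \<subseteq> frac R \<and> F = rspan R G) \<and> F \<noteq> {0}"

definition star_f :: "'k::field set \<Rightarrow> ('k set \<Rightarrow> 'k set) \<Rightarrow> 'k set \<Rightarrow> 'k set" where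
  "star_f R star E = \<Union>{star F | F. fg_frac_ideal R F \<and> F \<subseteq> E}"

definition star_tilde :: "'k::field set \<Rightarrow> ('k set \<Rightarrow> 'k set) \<Rightarrow> 'k set \<Rightarrow> 'k set" where
  "star_tilde R star E = {x \<in> frac R. \<exists>J. (\<exists>G. finite G \<and> G \<subseteq> R \<and> J = rspan R G) \<and> J \<noteq> {0}
                              \<and> star J = star R \<and> smul x J \<subseteq> E}"

definition mprod :: "'k::field set \<Rightarrow> 'k set \<Rightarrow> 'k set \<Rightarrow> 'k set" where
  "mprod R E F = rspan R {x * y | x y. x \<in> E \<and> y \<in> F}"

definition colon :: "'k::field set \<Rightarrow> 'k set \<Rightarrow> 'k set" where
  "colon R I = {x \<in> frac R. smul x I \<subseteq> R}"

definition star_f_invertible :: "'k::field set \<Rightarrow> ('k set \<Rightarrow> 'k set) \<Rightarrow> 'k set \<Rightarrow> bool" where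
  "star_f_invertible R star I \<longleftrightarrow> star_f R star (mprod R I (colon R I)) = star R"

definition fg_homog_ideal :: "'g set \<Rightarrow> ('g \<Rightarrow> 'k::field set) \<Rightarrow> 'k set \<Rightarrow> 'k set \<Rightarrow> bool" where
  "fg_homog_ideal \<Gamma> Rg R I \<longleftrightarrow> (\<exists>G. finite G \<and> G \<subseteq> R \<and> I = rspan R G)
      \<and> I = rspan R (I \<inter> homog \<Gamma> Rg)"

definition GPstarMD :: "'g set \<Rightarrow> ('g \<Rightarrow> 'k::field set) \<Rightarrow> 'k set \<Rightarrow> ('k set \<Rightarrow> 'k set) \<Rightarrow> bool" where
  "GPstarMD \<Gamma> Rg R star \<longleftrightarrow>
     (\<forall>I. fg_homog_ideal \<Gamma> Rg R I \<and> I \<noteq> {0} \<longrightarrow> star_f_invertible R star I)"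

end

theory Submission
  imports Defs "HOL-Library.Poly_Mapping" "HOL-Library.Product_Plus"
begin

text \<open>Call a finite subset of \<open>R\<close> dense if the ideal \<open>J\<close> it generates satisfies
  \<open>J\<^sup>\<star> = R\<^sup>\<star>\<close>. Dense sets are closed under products, so \<open>E\<close> and \<open>F\<close> have the same image under
  \<open>star_tilde\<close> as soon as every element of either one is multiplied into the other by some dense
  set, and a homogeneous ideal \<open>I\<close> is invertible iff \<open>1\<close> lies in \<open>star_tilde (I I\<^sup>-\<^sup>1)\<close>.

  If \<open>A\<^sub>f\<close> is invertible, then cancelling it \<open>n\<close> times from the Dedekind--Mertens formula
  \<open>A\<^sub>f\<^sup>n A\<^sub>f A\<^sub>g = A\<^sub>f\<^sup>n A\<^bsub>fg\<^esub>\<close> gives the content formula.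

  Conversely, for homogeneous \<open>a, b\<close> the content formula for \<open>(a + bX)(a - bX)\<close> gives a dense
  set of \<open>t\<close> with \<open>t a b = x a\<^sup>2 + y b\<^sup>2\<close>. Then \<open>u = y b / a\<close> satisfies \<open>u (t - u) = x y\<close>, so the
  content formula for \<open>(X - u)(X - (t - u)) = X\<^sup>2 - t X + x y\<close> puts \<open>u\<close> into \<open>star_tilde R\<close>: for a
  dense set of \<open>s\<close>, \<open>z = s u\<close> is in \<open>R\<close>, with \<open>z a \<in> b R\<close> and \<open>(s t - z) b \<in> a R\<close>. Thus \<open>(a, b)\<close> is
  invertible, and the case of more generators follows by comparing them two at a time.\<close>

section \<open>Unique sums in torsion-free groups\<close>

text \<open>Such a \<open>P\<close> consists of the nonnegative elements of a translation-invariant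
  partial order on \<open>Q\<close>; \<open>x - y \<in> P\<close> says that \<open>y\<close> is at
  most \<open>x\<close>.\<close>

definition pointed_cone :: "'g::ab_group_add set \<Rightarrow> 'g set \<Rightarrow> bool" where
  "pointed_cone Q P \<longleftrightarrow> P \<subseteq> Q \<and> 0 \<in> P \<and> (\<forall>x\<in>P. \<forall>y\<in>P. x + y \<in> P) \<and>
     (\<forall>x\<in>P. - x \<in> P \<longrightarrow> x = 0)"

text \<open>The sum \<open>(\<Sum>i<n. x)\<close> is the n-fold multiple of \<open>x\<close>,
  written as in \<open>graded_domain\<close>.\<close>

locale torsion_free_subgroup =
  fixes Q :: "'g::ab_group_add set"
  assumes zero_mem: "0 \<in> Q"
    and diff_mem: "\<And>x y. x \<in> Q \<Longrightarrow> y \<in> Q \<Longrightarrow> x - y \<in> Q"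
    and torsion_free: "\<And>n::nat. \<And>x. x \<in> Q \<Longrightarrow> n > 0 \<Longrightarrow> (\<Sum>i<n. x) = 0 \<Longrightarrow> x = 0"
begin

lemma uminus_mem: "x \<in> Q \<Longrightarrow> - x \<in> Q"
  using diff_mem[OF zero_mem] by simp

lemma add_mem: "x \<in> Q \<Longrightarrow> y \<in> Q \<Longrightarrow> x + y \<in> Q"
  using diff_mem[of x "- y"] uminus_mem by simp

end

lemma sum_const_add: "(\<Sum>i<m + n. x) = (\<Sum>i<m::nat. x) + (\<Sum>i<n. x :: 'g::ab_group_add)"
  by (induction n) (simp_all add: algebra_simps)

lemma sum_const_mult: "(\<Sum>i<m * n. x) = (\<Sum>i<m::nat. \<Sum>j<n. x :: 'g::ab_group_add)"
  by (induction m) (simp_all add: sum_const_add algebra_simps)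

lemma (in torsion_free_subgroup) sum_const_mem: "x \<in> Q \<Longrightarrow> (\<Sum>i<n::nat. x) \<in> Q"
  by (induction n) (simp_all add: zero_mem add_mem)

lemma pointed_cone_sum_const: "pointed_cone Q P \<Longrightarrow> x \<in> P \<Longrightarrow> (\<Sum>i<n::nat. x) \<in> P"
  by (induction n) (auto simp: pointed_cone_def)

text \<open>Adding the expressions for two opposite elements of the new set puts the negative of a
  multiple of \<open>x\<close> into \<open>P\<close>. By \<open>neg\<close> this multiple is the
  zeroth one, so both elements already lie in \<open>P\<close>.\<close>

lemma (in torsion_free_subgroup) pointed_cone_adjoin:
  assumes P: "pointed_cone Q P" and x: "x \<in> Q"
    and neg: "\<And>n::nat. n > 0 \<Longrightarrow> - (\<Sum>i<n. x) \<notin> P"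
  shows "pointed_cone Q {p + (\<Sum>i<n. x) | p (n::nat). p \<in> P}" (is "pointed_cone Q ?A")
proof -
  have zero: "0 \<in> P" and add: "\<And>a b. a \<in> P \<Longrightarrow> b \<in> P \<Longrightarrow> a + b \<in> P" and sub: "P \<subseteq> Q"
    and pointed: "\<And>a. a \<in> P \<Longrightarrow> - a \<in> P \<Longrightarrow> a = 0"
    using P by (auto simp: pointed_cone_def)
  have "?A \<subseteq> Q"
    using sub x by (auto intro!: add_mem sum_const_mem)
  moreover have "0 \<in> ?A"
    using zero by (auto intro!: exI[of _ "0::'g"] exI[of _ "0::nat"])
  moreover have "y + z \<in> ?A" if yA: "y \<in> ?A" and zA: "z \<in> ?A" for y z
  proof -
    obtain p n where y: "y = p + (\<Sum>i<n::nat. x)" "p \<in> P" using yA by blast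
    obtain q m where z: "z = q + (\<Sum>i<m::nat. x)" "q \<in> P" using zA by blast
    have "y + z = (p + q) + (\<Sum>i<n + m. x)"
      by (simp add: y z sum_const_add algebra_simps)
    then show ?thesis using add[OF y(2) z(2)] by blast
  qed
  moreover have "z = 0" if z1: "z \<in> ?A" and z2: "- z \<in> ?A" for z
  proof -
    obtain p n where y: "z = p + (\<Sum>i<n::nat. x)" "p \<in> P" using z1 by blast
    obtain q m where z: "- z = q + (\<Sum>i<m::nat. x)" "q \<in> P" using z2 by blast
    have "p + q + (\<Sum>i<n + m. x) = z + - z"
      unfolding y(1)[symmetric] z by (simp add: y(1) sum_const_add algebra_simps)
    then have "p + q = - (\<Sum>i<n + m. x)" by (simp add: eq_neg_iff_add_eq_0)
    with add[OF y(2) z(2)] neg[of "n + m"] have "n + m = 0" by (cases "n + m > 0") auto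
    then have "n = 0" "m = 0" by auto
    then show ?thesis using y z pointed[of z] by simp
  qed
  ultimately show ?thesis unfolding pointed_cone_def by blast
qed

text \<open>If neither \<open>x\<close> nor \<open>- x\<close> can be adjoined, then
  \<open>P\<close> contains a positive multiple of each. Passing to a common multiple gives two
  opposite elements of \<open>P\<close>, so a positive multiple of \<open>x\<close> is 0 and
  torsion-freeness applies.\<close>

lemma (in torsion_free_subgroup) pointed_cone_extend:
  assumes P: "pointed_cone Q P" and x: "x \<in> Q"
  obtains P' where "pointed_cone Q P'" "P \<subseteq> P'" "x \<in> P' \<or> - x \<in> P'"
proof -
  define A where "A y = {p + (\<Sum>i<n. y) | p (n::nat). p \<in> P}" for y
  have sub: "P \<subseteq> A y" for y
    by (force simp: A_def intro!: exI[of _ "0::nat"])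
  have mem: "y \<in> A y" for y
    using P by (force simp: A_def pointed_cone_def intro!: exI[of _ 0] exI[of _ "1::nat"])
  consider "\<forall>n::nat. n > 0 \<longrightarrow> - (\<Sum>i<n. x) \<notin> P"
    | "\<forall>n::nat. n > 0 \<longrightarrow> - (\<Sum>i<n. - x) \<notin> P"
    | m n where "m > 0" "- (\<Sum>i<m::nat. x) \<in> P" "n > 0" "- (\<Sum>i<n::nat. - x) \<in> P"
    by blast
  then show ?thesis
  proof cases
    case 1
    then have "pointed_cone Q (A x)"
      unfolding A_def by (intro pointed_cone_adjoin P x) auto
    then show ?thesis using that sub mem by blast
  next
    case 2
    then have "pointed_cone Q (A (- x))"
      unfolding A_def by (intro pointed_cone_adjoin P uminus_mem x) auto
    then show ?thesis using that sub mem by blast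
  next
    case 3
    have m: "(\<Sum>i<n. - (\<Sum>i<m. x)) \<in> P" and n: "(\<Sum>i<m. - (\<Sum>i<n. - x)) \<in> P"
      using 3 P by (auto intro: pointed_cone_sum_const)
    have "(\<Sum>i<n. - (\<Sum>i<m. x)) = - (\<Sum>i<n * m. x)"
      by (simp only: sum_negf sum_const_mult)
    moreover have "(\<Sum>i<m. - (\<Sum>i<n. - x)) = (\<Sum>i<m * n. x)"
      by (simp only: sum_negf sum_const_mult minus_minus)
    ultimately have "(\<Sum>i<m * n. x) = 0"
      using m n P by (auto simp: pointed_cone_def mult.commute)
    then have "x = 0"
      using torsion_free[OF x] 3 by (metis nat_0_less_mult_iff)
    then show ?thesis using that[of P] P by (auto simp: pointed_cone_def)
  qed
qed

text \<open>Cones only grow under extension, so comparisons once decided stay decided, and finitely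
  many one-element extensions suffice.\<close>

lemma (in torsion_free_subgroup) pointed_cone_total_on:
  assumes "finite D" "D \<subseteq> Q"
  obtains P where "pointed_cone Q P" "\<And>x. x \<in> D \<Longrightarrow> x \<in> P \<or> - x \<in> P"
proof -
  have "\<exists>P. pointed_cone Q P \<and> (\<forall>x\<in>D. x \<in> P \<or> - x \<in> P)"
    using assms
  proof (induction D rule: finite_induct)
    case empty
    have "pointed_cone Q {0}" by (simp add: pointed_cone_def zero_mem)
    then show ?case by auto
  next
    case (insert d D)
    then obtain P where P: "pointed_cone Q P" "\<forall>x\<in>D. x \<in> P \<or> - x \<in> P" by auto
    obtain P' where "pointed_cone Q P'" "P \<subseteq> P'" "d \<in> P' \<or> - d \<in> P'"
      using pointed_cone_extend[OF P(1)] insert.prems by blast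
    then show ?case using P by blast
  qed
  then show ?thesis using that by blast
qed

section \<open>Largest elements and uniquely represented sums\<close>

lemma pointed_cone_maximum:
  assumes P: "pointed_cone Q P" and "finite A" "A \<noteq> {}"
    and total: "\<And>a b. a \<in> A \<Longrightarrow> b \<in> A \<Longrightarrow> a - b \<in> P \<or> b - a \<in> P"
  obtains a where "a \<in> A" "\<And>b. b \<in> A \<Longrightarrow> a - b \<in> P"
proof -
  have zero: "0 \<in> P" and add: "\<And>a b. a \<in> P \<Longrightarrow> b \<in> P \<Longrightarrow> a + b \<in> P"
    using P by (auto simp: pointed_cone_def)
  have "\<exists>a\<in>A. \<forall>b\<in>A. a - b \<in> P"
    using assms(2-4)
  proof (induction A rule: finite_ne_induct)
    case (singleton a)
    then show ?case using zero by simp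
  next
    case (insert c A)
    then obtain a where a: "a \<in> A" "\<forall>b\<in>A. a - b \<in> P" by blast
    show ?case
    proof (cases "a - c \<in> P")
      case True
      then show ?thesis using a by blast
    next
      case False
      then have ca: "c - a \<in> P" using insert.prems[of a c] a by blast
      have "c - b \<in> P" if "b \<in> A" for b
        using add[OF ca] a that by force
      then show ?thesis using zero by auto
    qed
  qed
  then show ?thesis using that by blast
qed

text \<open>The sum of the largest element of \<open>A\<close> and the largest element of
  \<open>B\<close> has no second representation: \<open>a - a'\<close> and its negative
  \<open>b - b'\<close> would both be nonnegative.\<close>

lemma (in torsion_free_subgroup) unique_sum:
  assumes "finite A" "A \<noteq> {}" "A \<subseteq> Q" "finite B" "B \<noteq> {}" "B \<subseteq> Q"
  obtains a b where "a \<in> A" "b \<in> B"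
    "\<And>a' b'. a' \<in> A \<Longrightarrow> b' \<in> B \<Longrightarrow> a' + b' = a + b \<Longrightarrow> a' = a \<and> b' = b"
proof -
  \<comment> \<open>These are all the differences whose sign the order must decide for
    \<open>A\<close> and \<open>B\<close> to have largest elements.\<close>
  define D where "D = (\<lambda>(x, y). x - y) ` (A \<times> A) \<union> (\<lambda>(x, y). x - y) ` (B \<times> B)"
  have "finite D" "D \<subseteq> Q" using assms by (auto simp: D_def intro: diff_mem)
  then obtain P where P: "pointed_cone Q P" and total: "\<And>x. x \<in> D \<Longrightarrow> x \<in> P \<or> - x \<in> P"
    using pointed_cone_total_on by metis
  have "x - y \<in> P \<or> y - x \<in> P" if "x \<in> A \<and> y \<in> A \<or> x \<in> B \<and> y \<in> B" for x y
    using total[of "x - y"] that by (force simp: D_def)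
  then obtain a b where a: "a \<in> A" "\<And>b. b \<in> A \<Longrightarrow> a - b \<in> P"
    and b: "b \<in> B" "\<And>c. c \<in> B \<Longrightarrow> b - c \<in> P"
    using pointed_cone_maximum[OF P] assms by metis
  have uniq: "a' = a \<and> b' = b" if "a' \<in> A" "b' \<in> B" "a' + b' = a + b" for a' b'
  proof -
    have "- (a - a') = b - b'"
      using that(3) by (simp add: algebra_simps)
    with P a(2)[OF that(1)] b(2)[OF that(2)] have "a - a' = 0"
      unfolding pointed_cone_def by metis
    then show ?thesis using that(3) by auto
  qed
  show ?thesis by (rule that[OF a(1) b(1) uniq])
qed

text \<open>Compare the second coordinates first.\<close>

lemma (in torsion_free_subgroup) unique_sum_Times_nat:
  fixes A B :: "('g \<times> nat) set"
  assumes "finite A" "A \<noteq> {}" "fst ` A \<subseteq> Q" "finite B" "B \<noteq> {}" "fst ` B \<subseteq> Q"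
  obtains a b where "a \<in> A" "b \<in> B"
    "\<And>a' b'. a' \<in> A \<Longrightarrow> b' \<in> B \<Longrightarrow> a' + b' = a + b \<Longrightarrow> a' = a \<and> b' = b"
proof -
  define i j where "i = Max (snd ` A)" and "j = Max (snd ` B)"
  have i: "i \<in> snd ` A" and j: "j \<in> snd ` B"
    unfolding i_def j_def using assms by (intro Max_in; simp)+
  have i_max: "snd x \<le> i" if "x \<in> A" for x
    unfolding i_def using assms(1) that by simp
  have j_max: "snd x \<le> j" if "x \<in> B" for x
    unfolding j_def using assms(4) that by simp
  define A' B' where "A' = fst ` {x \<in> A. snd x = i}" and "B' = fst ` {x \<in> B. snd x = j}"
  have "finite A'" "A' \<noteq> {}" "A' \<subseteq> Q" "finite B'" "B' \<noteq> {}" "B' \<subseteq> Q"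
    using assms i j by (auto simp: A'_def B'_def)
  then obtain a b where ab: "a \<in> A'" "b \<in> B'"
    "\<And>a' b'. a' \<in> A' \<Longrightarrow> b' \<in> B' \<Longrightarrow> a' + b' = a + b \<Longrightarrow> a' = a \<and> b' = b"
    using unique_sum by metis
  have uniq: "a' = (a, i) \<and> b' = (b, j)"
    if a': "a' \<in> A" and b': "b' \<in> B" and eq: "a' + b' = (a, i) + (b, j)" for a' b'
  proof -
    have eqs: "fst a' + fst b' = a + b" "snd a' + snd b' = i + j"
      using eq by (metis add_Pair fst_add fst_conv, metis add_Pair snd_add snd_conv)
    have s: "snd a' = i" "snd b' = j"
      using i_max[OF a'] j_max[OF b'] eqs(2) by linarith+
    then have "fst a' \<in> A'" "fst b' \<in> B'" using a' b' by (auto simp: A'_def B'_def)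
    then show ?thesis using ab(3) eqs(1) s by (metis prod.collapse)
  qed
  have "(a, i) \<in> A" "(b, j) \<in> B"
    using ab(1,2) by (auto simp: A'_def B'_def)
  then show ?thesis by (rule that[OF _ _ uniq])
qed

section \<open>The content formula of Dedekind and Mertens\<close>

abbreviation "lookup \<equiv> Poly_Mapping.lookup"
abbreviation "keys \<equiv> Poly_Mapping.keys"

lemma poly_mapping_sum_single: "(\<Sum>x\<in>keys F. Poly_Mapping.single x (lookup F x)) = F"
  by (rule poly_mapping_eqI)
     (simp add: lookup_sum lookup_single when_def in_keys_iff)

lemma lookup_mult_keys:
  fixes F G :: "'i::comm_monoid_add \<Rightarrow>\<^sub>0 'k::comm_ring_1"
  shows "lookup (F * G) z =
    (\<Sum>x\<in>keys F. \<Sum>y\<in>keys G. lookup F x * lookup G y when x + y = z)"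
proof -
  have "F * G = (\<Sum>x\<in>keys F. \<Sum>y\<in>keys G. Poly_Mapping.single (x + y) (lookup F x * lookup G y))"
    by (subst (1 2) poly_mapping_sum_single[symmetric])
       (simp only: sum_product mult_single)
  then show ?thesis by (simp add: lookup_sum lookup_single)
qed

text \<open>By cancellation at most one \<open>y\<close> satisfies \<open>z = a + y\<close>.\<close>

lemma lookup_mult_single:
  fixes G :: "'i::cancel_comm_monoid_add \<Rightarrow>\<^sub>0 'k::comm_ring_1"
  shows "lookup (Poly_Mapping.single a c * G) z = 0 \<or>
    (\<exists>y. z = a + y \<and> lookup (Poly_Mapping.single a c * G) z = c * lookup G y)"
proof (cases "\<exists>y\<in>keys G. z = a + y")
  case True
  then obtain y where y: "y \<in> keys G" "z = a + y" by blast
  then have "lookup (Poly_Mapping.single a c * G) z = c * lookup G y"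
    by (auto simp: lookup_mult_keys when_def sum.If_cases)
  then show ?thesis using y by blast
next
  case False
  then show ?thesis by (auto simp: lookup_mult_keys when_def intro!: sum.neutral)
qed

lemma lookup_mult_unique:
  fixes F G :: "'i::cancel_comm_monoid_add \<Rightarrow>\<^sub>0 'k::comm_ring_1"
  assumes "a \<in> keys F" "b \<in> keys G"
    "\<And>a' b'. a' \<in> keys F \<Longrightarrow> b' \<in> keys G \<Longrightarrow> a' + b' = a + b \<Longrightarrow> a' = a \<and> b' = b"
  shows "lookup (F * G) (a + b) = lookup F a * lookup G b"
proof -
  have "lookup (F * G) (a + b) =
    (\<Sum>x\<in>keys F. if x = a then \<Sum>y\<in>keys G. if y = b then lookup F a * lookup G b else 0 else 0)"
    unfolding lookup_mult_keys
    by (intro sum.cong refl) (use assms(3) in \<open>auto simp: when_def intro!: sum.cong sum.neutral\<close>)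
  also have "\<dots> = lookup F a * lookup G b"
    using assms(1,2) by simp
  finally show ?thesis .
qed

text \<open>In the Dedekind-Mertens induction an inclusion between products of contents becomes a
  membership of products of coefficients in an arbitrary subgroup \<open>N\<close>.\<close>

definition add_subgroup :: "'k::ab_group_add set \<Rightarrow> bool" where
  "add_subgroup N \<longleftrightarrow> 0 \<in> N \<and> (\<forall>x\<in>N. \<forall>y\<in>N. x - y \<in> N)"

text \<open>A fixed factor \<open>a\<close> can thus be absorbed into the target subgroup before the
  induction hypothesis is applied.\<close>

lemma add_subgroup_preimage_mult:
  "add_subgroup N \<Longrightarrow> add_subgroup {x. a * x \<in> (N :: 'k::comm_ring_1 set)}"
  by (auto simp: add_subgroup_def right_diff_distrib)

definition unique_sums :: "'i::cancel_comm_monoid_add set \<Rightarrow> bool" where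
  "unique_sums U \<longleftrightarrow> (\<forall>A B. finite A \<and> A \<noteq> {} \<and> A \<subseteq> U \<and> finite B \<and> B \<noteq> {} \<and> B \<subseteq> U \<longrightarrow>
     (\<exists>a\<in>A. \<exists>b\<in>B. \<forall>a'\<in>A. \<forall>b'\<in>B. a' + b' = a + b \<longrightarrow> a' = a \<and> b' = b))"

text \<open>This is \<open>c(F)\<^sup>n c(G) = c(F)\<^sup>n\<^sup>-\<^sup>1 c(FG)\<close> in terms of generators. Removing from both factors
  the terms at a pair \<open>a, b\<close> with uniquely represented sum changes \<open>FG\<close> by multiples of the two
  removed coefficients only, and their product is a coefficient of \<open>FG\<close>.\<close>

theorem dedekind_mertens:
  fixes F G :: "'i::cancel_comm_monoid_add \<Rightarrow>\<^sub>0 'k::comm_ring_1"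
  assumes "unique_sums U" and "keys F \<subseteq> U" "keys G \<subseteq> U" "card (keys G) = Suc n" "add_subgroup N"
    and "\<And>xs z. length xs = n \<Longrightarrow> prod_list (map (lookup F) xs) * lookup (F * G) z \<in> N"
    and "length xs = Suc n"
  shows "prod_list (map (lookup F) xs) * lookup G y \<in> N"
  using assms(2-)
\<comment> \<open>The measure is the total number of terms. Removing a term of \<open>G\<close>
  lowers \<open>n\<close> and moves a factor into \<open>N\<close>, so both must vary.\<close>
proof (induction "card (keys F) + card (keys G)" arbitrary: F G n N xs y rule: less_induct)
  case less
  note N = less.prems(4)
  have N0: "0 \<in> N" and Nd: "\<And>x y. x \<in> N \<Longrightarrow> y \<in> N \<Longrightarrow> x - y \<in> N"
    using N by (auto simp: add_subgroup_def)
  have "keys G \<noteq> {}" using less.prems(3) by auto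
  show ?case
  proof (cases "keys F = {}")
    case True
    then have "lookup F x = 0" for x by (metis empty_iff in_keys_iff)
    \<comment> \<open>The list has length \<open>Suc n\<close>, so at least one vanishing factor is
      present.\<close>
    moreover obtain x xs' where "xs = x # xs'" using less.prems(6) by (cases xs) auto
    ultimately show ?thesis using N0 by simp
  next
    case False
    have "\<exists>a\<in>keys F. \<exists>b\<in>keys G. \<forall>a'\<in>keys F. \<forall>b'\<in>keys G. a' + b' = a + b \<longrightarrow> a' = a \<and> b' = b"
      using assms(1) False \<open>keys G \<noteq> {}\<close> less.prems(1,2) unfolding unique_sums_def by auto
    then obtain a b where a: "a \<in> keys F" and b: "b \<in> keys G"
      and uniq: "\<And>a' b'. a' \<in> keys F \<Longrightarrow> b' \<in> keys G \<Longrightarrow> a' + b' = a + b \<Longrightarrow> a' = a \<and> b' = b"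
      by blast
    define F' G' where "F' = F - Poly_Mapping.single a (lookup F a)"
      and "G' = G - Poly_Mapping.single b (lookup G b)"
    have lF: "lookup F' x = (if x = a then 0 else lookup F x)" for x
      by (simp add: F'_def lookup_minus lookup_single when_def)
    have lG: "lookup G' x = (if x = b then 0 else lookup G x)" for x
      by (simp add: G'_def lookup_minus lookup_single when_def)
    have kF: "keys F' = keys F - {a}" and kG: "keys G' = keys G - {b}"
      unfolding set_eq_iff Diff_iff in_keys_iff lF lG by simp_all
    have ab: "lookup F a * lookup G b = lookup (F * G) (a + b)"
      by (rule lookup_mult_unique[OF a b, symmetric]) (rule uniq)
    define p where "p xs = prod_list (map (lookup F) xs)" for xs
    have p_Cons: "p (x # xs) = lookup F x * p xs" for x xs by (simp add: p_def)
    have hyp: "p xs * lookup (F * G) z \<in> N" if "length xs = n" for xs z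
      using less.prems(5)[OF that] by (simp add: p_def)
    \<comment> \<open>One coefficient at \<open>a\<close> and only \<open>n\<close> further factors.
      At \<open>d = b\<close> the pair is a coefficient of \<open>F * G\<close>; otherwise
      \<open>G\<close> may be replaced by \<open>G'\<close>, with the factor at \<open>a\<close>
      absorbed into the target.\<close>
    have withA: "lookup F a * (p xs * lookup G d) \<in> N" if len: "length xs = n" for xs d
    proof (cases "d = b")
      case True
      then show ?thesis using hyp[OF len] by (metis ab mult.left_commute)
    next
      case db: False
      show ?thesis
      proof (cases n)
        case 0
        then have "keys G = {b}" using less.prems(3) b by (auto simp: card_Suc_eq)
        then have "lookup G d = 0" using db by (metis in_keys_iff singletonD)
        then show ?thesis using N0 by simp
      next
        case (Suc m)
        have "p xs * lookup G' d \<in> {x. lookup F a * x \<in> N}"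
          unfolding p_def
        proof (rule less.hyps[of F G' m])
          show "card (keys F) + card (keys G') < card (keys F) + card (keys G)"
            using b card_Diff1_less[of "keys G" b] by (simp add: kG)
          show "keys G' \<subseteq> U" "card (keys G') = Suc m"
            using less.prems(2,3) b Suc by (auto simp: kG)
          show "add_subgroup {x. lookup F a * x \<in> N}"
            by (rule add_subgroup_preimage_mult[OF N])
          fix us :: "'i list" and z :: 'i
          assume us: "length us = m"
          have FG': "F * G' = F * G - Poly_Mapping.single b (lookup G b) * F"
            by (simp add: G'_def algebra_simps)
          \<comment> \<open>The factor at \<open>a\<close> restores the length from \<open>m\<close>
            to \<open>n\<close>, as \<open>hyp\<close> requires.\<close>
          have 1: "lookup F a * (p us * lookup (F * G) z) \<in> N"
            using hyp[of "a # us" z] us Suc by (simp add: p_Cons mult.assoc)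
          \<comment> \<open>A coefficient of the subtracted product is the coefficient of
            \<open>G\<close> at \<open>b\<close> times one of \<open>F\<close>. The latter joins the
            list, and the former pairs with the factor at \<open>a\<close> into a coefficient of
            \<open>F * G\<close>.\<close>
          have 2: "lookup F a * (p us * lookup (Poly_Mapping.single b (lookup G b) * F) z) \<in> N"
            using lookup_mult_single[of b "lookup G b" F z]
          proof (elim disjE exE conjE)
            fix y assume "lookup (Poly_Mapping.single b (lookup G b) * F) z = lookup G b * lookup F y"
            then have "lookup F a * (p us * lookup (Poly_Mapping.single b (lookup G b) * F) z)
                = p (y # us) * (lookup F a * lookup G b)" by (simp add: p_Cons mult_ac)
            then show ?thesis using hyp[of "y # us"] us Suc by (simp add: ab)
          qed (use N0 in simp)
          show "prod_list (map (lookup F) us) * lookup (F * G') z \<in> {x. lookup F a * x \<in> N}"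
            using Nd[OF 1 2] by (simp add: FG' lookup_minus p_def algebra_simps)
        qed (use less.prems len Suc in auto)
        then show ?thesis using db by (simp add: lG)
      qed
    qed
    show ?thesis
    \<comment> \<open>If \<open>a\<close> occurs in the list, one occurrence is pulled out and
      \<open>withA\<close> applies. Otherwise the term of \<open>F\<close> at \<open>a\<close> does
      not enter the claim and is dropped.\<close>
    proof (cases "a \<in> set xs")
      case True
      then obtain us vs where xs: "xs = us @ a # vs" by (meson split_list)
      have "p xs = lookup F a * p (us @ vs)"
        unfolding p_def xs by (simp add: mult.left_commute)
      then show ?thesis
        using withA[of "us @ vs" y] less.prems(6) unfolding p_def[symmetric]
        by (simp add: xs mult.assoc del: map_append)
    next
      case False
      have "prod_list (map (lookup F') xs) * lookup G y \<in> N"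
      proof (rule less.hyps[of F' G n])
        show "card (keys F') + card (keys G) < card (keys F) + card (keys G)"
          using a card_Diff1_less[of "keys F" a] by (simp add: kF)
        fix us :: "'i list" and z :: 'i
          assume us: "length us = n"
        have F'G: "F' * G = F * G - Poly_Mapping.single a (lookup F a) * G"
          by (simp add: F'_def algebra_simps)
        show "prod_list (map (lookup F') us) * lookup (F' * G) z \<in> N"
        \<comment> \<open>A list through \<open>a\<close> gives the product 0, since
          \<open>F'\<close> has no term there; on other lists \<open>F'\<close> and \<open>F\<close>
          agree.\<close>
        proof (cases "a \<in> set us")
          case True
          then have "prod_list (map (lookup F') us) = 0"
            by (induction us) (auto simp: lF)
          then show ?thesis using N0 by simp
        next
          case False
          then have eq: "prod_list (map (lookup F') us) = p us"
            unfolding p_def by (intro arg_cong[of _ _ prod_list] map_cong) (auto simp: lF)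
          have "p us * lookup (Poly_Mapping.single a (lookup F a) * G) z \<in> N"
            using lookup_mult_single[of a "lookup F a" G z]
          proof (elim disjE exE conjE)
            fix y assume "lookup (Poly_Mapping.single a (lookup F a) * G) z = lookup F a * lookup G y"
            then show ?thesis using withA[OF us, of y] by (simp add: mult_ac)
          qed (use N0 in simp)
          with Nd[OF hyp[OF us, of z]] show ?thesis
            by (simp add: eq F'G lookup_minus right_diff_distrib)
        qed
      qed (use less.prems kF in auto)
      moreover have "map (lookup F') xs = map (lookup F) xs"
        using False by (auto simp: lF)
      ultimately show ?thesis by simp
    qed
  qed
qed

section \<open>The operation associated with a semistar operation\<close>

lemma rspan_base:
  assumes "1 \<in> R" "x \<in> S"
  shows "x \<in> rspan R S"
  unfolding rspan_def
  using assms by (auto intro!: exI[of _ "{x}"] exI[of _ "\<lambda>_. 1"])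

lemma submod_sum: "submod R E \<Longrightarrow> (\<And>x. x \<in> A \<Longrightarrow> f x \<in> E) \<Longrightarrow> sum f A \<in> E"
  by (induction A rule: infinite_finite_induct) (auto simp: submod_def)

lemma rspan_least:
  assumes "submod R E" "S \<subseteq> E"
  shows "rspan R S \<subseteq> E"
  using assms unfolding rspan_def
  by (auto intro!: submod_sum) (auto simp: submod_def)

lemma rspan_add:
  assumes R: "0 \<in> R" "\<And>a b. a \<in> R \<Longrightarrow> b \<in> R \<Longrightarrow> a + b \<in> R"
    and "x \<in> rspan R S" "y \<in> rspan R S"
  shows "x + y \<in> rspan R S"
proof -
  obtain F r where F: "finite F" "F \<subseteq> S" "\<forall>s\<in>F. r s \<in> R" "x = (\<Sum>s\<in>F. r s * s)"
    using assms(3) by (auto simp: rspan_def)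
  obtain G t where G: "finite G" "G \<subseteq> S" "\<forall>s\<in>G. t s \<in> R" "y = (\<Sum>s\<in>G. t s * s)"
    using assms(4) by (auto simp: rspan_def)
  \<comment> \<open>Both coefficient families are extended by 0 to the union of their
    supports.\<close>
  define u where "u s = (if s \<in> F then r s else 0) + (if s \<in> G then t s else 0)" for s
  have "(\<Sum>s\<in>F \<union> G. (if s \<in> F then r s else 0) * s) = x"
    unfolding F(4) by (rule sum.mono_neutral_cong_right) (use F G in auto)
  moreover have "(\<Sum>s\<in>F \<union> G. (if s \<in> G then t s else 0) * s) = y"
    unfolding G(4) by (rule sum.mono_neutral_cong_right) (use F G in auto)
  ultimately have "x + y = (\<Sum>s\<in>F \<union> G. u s * s)"
    unfolding u_def by (simp only: distrib_right sum.distrib)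
  moreover have "\<forall>s\<in>F \<union> G. u s \<in> R" using F(3) G(3) R by (auto simp: u_def)
  ultimately show ?thesis unfolding rspan_def using F(1,2) G(1,2)
    by (auto intro!: exI[of _ "F \<union> G"] exI[of _ u])
qed

lemma rspan_mult:
  assumes "\<And>a b. a \<in> R \<Longrightarrow> b \<in> R \<Longrightarrow> a * b \<in> R" "r \<in> R" "x \<in> rspan R S"
  shows "r * x \<in> rspan R S"
proof -
  obtain F t where F: "finite F" "F \<subseteq> S" "\<forall>s\<in>F. t s \<in> R" "x = (\<Sum>s\<in>F. t s * s)"
    using assms(3) by (auto simp: rspan_def)
  then have "r * x = (\<Sum>s\<in>F. (r * t s) * s)" by (simp add: sum_distrib_left mult.assoc)
  then show ?thesis unfolding rspan_def using F assms(1,2)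
    by (auto intro!: exI[of _ F] exI[of _ "\<lambda>s. r * t s"])
qed

section \<open>Subrings of a field and submodules of the quotient field\<close>

locale field_subring =
  fixes R :: "'k::field set"
  assumes subring: "is_subring R"
begin

lemma zero: "0 \<in> R" and one: "1 \<in> R" and add: "x \<in> R \<Longrightarrow> y \<in> R \<Longrightarrow> x + y \<in> R"
  and mult: "x \<in> R \<Longrightarrow> y \<in> R \<Longrightarrow> x * y \<in> R" and uminus: "x \<in> R \<Longrightarrow> - x \<in> R"
  using subring by (auto simp: is_subring_def)

lemma diff: "x \<in> R \<Longrightarrow> y \<in> R \<Longrightarrow> x - y \<in> R"
  using add[of x "- y"] uminus by simp

lemma fracI: "a \<in> R \<Longrightarrow> b \<in> R \<Longrightarrow> b \<noteq> 0 \<Longrightarrow> a / b \<in> frac R"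
  by (auto simp: frac_def)

lemma subset_frac: "R \<subseteq> frac R"
  using one fracI[of _ 1] by auto

lemma frac_mult:
  assumes "x \<in> frac R" "y \<in> frac R"
  shows "x * y \<in> frac R"
proof -
  obtain a b c d where "x = a / b" "y = c / d" "a \<in> R" "b \<in> R" "b \<noteq> 0" "c \<in> R" "d \<in> R" "d \<noteq> 0"
    using assms by (auto simp: frac_def)
  then show ?thesis using fracI[of "a * c" "b * d"] mult by simp
qed

lemma frac_add:
  assumes "x \<in> frac R" "y \<in> frac R"
  shows "x + y \<in> frac R"
proof -
  obtain a b c d where "x = a / b" "y = c / d" "a \<in> R" "b \<in> R" "b \<noteq> 0" "c \<in> R" "d \<in> R" "d \<noteq> 0"
    using assms by (auto simp: frac_def)
  then have "x + y = (a * d + c * b) / (b * d)" "a * d + c * b \<in> R" "b * d \<in> R" "b * d \<noteq> 0"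
    by (auto simp: add_frac_eq mult add)
  then show ?thesis using fracI by metis
qed

lemma frac_divide:
  assumes "x \<in> frac R" "y \<in> frac R"
  shows "x / y \<in> frac R"
proof (cases "y = 0")
  case True
  then show ?thesis using subset_frac zero by auto
next
  case False
  obtain a b c d where "x = a / b" "y = c / d" "a \<in> R" "b \<in> R" "b \<noteq> 0" "c \<in> R" "d \<in> R" "d \<noteq> 0"
    using assms by (auto simp: frac_def)
  then show ?thesis using False fracI[of "a * d" "b * c"] mult by simp
qed

lemma submod_self: "submod R R"
  using subset_frac zero add mult by (auto simp: submod_def)

lemma submod_frac: "submod R (frac R)"
  using subset_frac zero frac_add frac_mult by (auto simp: submod_def)

lemma submod_rspan: "S \<subseteq> frac R \<Longrightarrow> submod R (rspan R S)"
  unfolding submod_def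
  using rspan_least[OF submod_frac] rspan_add[of R] rspan_mult[of R] zero add mult
  by (auto simp: rspan_def intro!: exI[of _ "{}"])

lemma rspan_mem: "x \<in> S \<Longrightarrow> x \<in> rspan R S"
  by (rule rspan_base[OF one])

lemma rspan_nonzero:
  assumes "S \<subseteq> frac R" "rspan R S \<noteq> {0}"
  shows "\<exists>x\<in>S. x \<noteq> 0"
proof (rule ccontr)
  assume "\<not> ?thesis"
  then have "rspan R S \<subseteq> {0}"
    using zero subset_frac by (intro rspan_least) (auto simp: submod_def)
  then show False using submod_rspan[OF assms(1)] assms(2) by (auto simp: submod_def)
qed

lemma rspan_mono: "S \<subseteq> S' \<Longrightarrow> S' \<subseteq> frac R \<Longrightarrow> rspan R S \<subseteq> rspan R S'"
  using rspan_least[OF submod_rspan] rspan_mem by blast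

lemma submod_uminus: "submod R E \<Longrightarrow> x \<in> E \<Longrightarrow> - x \<in> E"
  using uminus[OF one] unfolding submod_def by (metis mult_minus1)

lemma submod_diff: "submod R E \<Longrightarrow> x \<in> E \<Longrightarrow> y \<in> E \<Longrightarrow> x - y \<in> E"
  using submod_uminus[of E y] unfolding submod_def by (metis add_uminus_conv_diff)

text \<open>Together with \<open>rspan_least\<close> this reduces a claim
  \<open>x * v \<in> E\<close> for all \<open>v\<close> of a span to its generators.\<close>

lemma submod_preimage_mult:
  "submod R E \<Longrightarrow> submod R {v \<in> frac R. x * v \<in> E}"
  using submod_frac unfolding submod_def
  by (auto simp: distrib_left mult.left_commute)

lemma submod_smul:
  assumes h: "h \<in> frac R" and E: "submod R E"
  shows "submod R (smul h E)"
  unfolding submod_def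
proof (intro conjI ballI)
  show "smul h E \<subseteq> frac R"
    using h E frac_mult unfolding smul_def submod_def by blast
  have "h * 0 \<in> smul h E" using E unfolding smul_def submod_def by blast
  then show "0 \<in> smul h E" by simp
  show "x + y \<in> smul h E" if x: "x \<in> smul h E" and y: "y \<in> smul h E" for x y
  proof -
    obtain u v where "x = h * u" "u \<in> E" "y = h * v" "v \<in> E"
      using x y unfolding smul_def by blast
    then have "x + y = h * (u + v)" "u + v \<in> E"
      using E by (simp_all add: distrib_left submod_def)
    then show ?thesis unfolding smul_def by blast
  qed
  show "r * x \<in> smul h E" if r: "r \<in> R" and x: "x \<in> smul h E" for r x
  proof -
    obtain u where "x = h * u" "u \<in> E"
      using x unfolding smul_def by blast
    then have "r * x = h * (r * u)" "r * u \<in> E"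
      using E r by (simp_all add: mult.left_commute submod_def)
    then show ?thesis unfolding smul_def by blast
  qed
qed

lemma mprod_mem: "x \<in> E \<Longrightarrow> y \<in> F \<Longrightarrow> x * y \<in> mprod R E F"
  unfolding mprod_def by (rule rspan_mem) blast

lemma submod_mprod: "E \<subseteq> frac R \<Longrightarrow> F \<subseteq> frac R \<Longrightarrow> submod R (mprod R E F)"
  unfolding mprod_def by (rule submod_rspan) (auto intro: frac_mult)

lemma mprod_least:
  "submod R M \<Longrightarrow> (\<And>x y. x \<in> E \<Longrightarrow> y \<in> F \<Longrightarrow> x * y \<in> M) \<Longrightarrow> mprod R E F \<subseteq> M"
  unfolding mprod_def by (rule rspan_least) auto

lemma colon_mprod_subset: "mprod R I (colon R I) \<subseteq> R"
  by (rule mprod_least[OF submod_self]) (auto simp: colon_def smul_def mult.commute)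

lemma colon_subset: "colon R I \<subseteq> frac R"
  by (auto simp: colon_def)

lemma rspan_one: "rspan R {1} = R"
proof
  show "rspan R {1} \<subseteq> R" by (rule rspan_least[OF submod_self]) (use one in auto)
  have "submod R (rspan R {1})" using one subset_frac by (intro submod_rspan) auto
  then show "R \<subseteq> rspan R {1}" using rspan_mem[of 1 "{1}"] by (force simp: submod_def)
qed

end

section \<open>Semistar operations and dense sets\<close>

locale semistar_domain = field_subring R for R :: "'k::field set" +
  fixes star :: "'k set \<Rightarrow> 'k set"
  assumes semistar: "semistar R star"
begin

abbreviation tilde :: "'k set \<Rightarrow> 'k set" where
  "tilde \<equiv> star_tilde R star"

text \<open>Generators are recorded instead of the ideal, so that conditions are checked on finitely
  many elements. The span is required to be nonzero because the semistar axioms speak of nonzero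
  submodules.\<close>

definition dense :: "'k set \<Rightarrow> bool" where
  "dense G \<longleftrightarrow> finite G \<and> G \<subseteq> R \<and> rspan R G \<noteq> {0} \<and> star (rspan R G) = star R"

lemma nz_submod_self: "nz_submod R R"
  using submod_self one by (auto simp: nz_submod_def)

lemma star_submod: "nz_submod R E \<Longrightarrow> submod R (star E)"
  and star_extensive: "nz_submod R E \<Longrightarrow> E \<subseteq> star E"
  and star_mono: "nz_submod R E \<Longrightarrow> nz_submod R F \<Longrightarrow> E \<subseteq> F \<Longrightarrow> star E \<subseteq> star F"
  and star_idem: "nz_submod R E \<Longrightarrow> star (star E) = star E"
  and nz_submod_star: "nz_submod R E \<Longrightarrow> nz_submod R (star E)"
  and star_smul: "x \<in> frac R \<Longrightarrow> x \<noteq> 0 \<Longrightarrow> nz_submod R E \<Longrightarrow> star (smul x E) = smul x (star E)"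
  using semistar unfolding semistar_def by (auto simp: nz_submod_def)

lemma star_eqI:
  assumes E: "nz_submod R E" and F: "nz_submod R F" and "E \<subseteq> F" "F \<subseteq> star E"
  shows "star E = star F"
  using star_mono[OF E F] star_mono[OF F nz_submod_star[OF E]] star_idem[OF E] assms(3,4) by auto

lemma nz_submod_rspan: "G \<subseteq> frac R \<Longrightarrow> rspan R G \<noteq> {0} \<Longrightarrow> nz_submod R (rspan R G)"
  by (simp add: nz_submod_def submod_rspan)

text \<open>A submodule containing 1 contains \<open>R\<close>; monotonicity and idempotence of
  \<open>star\<close> then force equality.\<close>

lemma denseI:
  assumes "finite G" "G \<subseteq> R" "rspan R G \<noteq> {0}" "1 \<in> star (rspan R G)"
  shows "dense G"
proof -
  have G: "nz_submod R (rspan R G)"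
    using assms subset_frac by (intro nz_submod_rspan) auto
  have "R \<subseteq> star (rspan R G)"
    using star_submod[OF G] assms(4) by (force simp: submod_def)
  moreover have "rspan R G \<subseteq> R" by (rule rspan_least[OF submod_self assms(2)])
  ultimately have "star (rspan R G) = star R"
    by (intro star_eqI G nz_submod_self)
  then show ?thesis using assms by (simp add: dense_def)
qed

lemma dense_one: "dense {1}"
  using one zero_neq_one unfolding dense_def rspan_one by auto

text \<open>For nonzero \<open>h\<close> in \<open>H\<close>, the closure of \<open>h\<close> times
  the ideal of \<open>G\<close> is \<open>h\<close> times \<open>star R\<close>. It contains
  \<open>h\<close> and lies in the closure of the product ideal, which therefore contains all of
  \<open>H\<close> and then \<open>star R\<close>.\<close>

lemma dense_mult:
  assumes G: "dense G" and H: "dense H"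
  shows "dense {g * h | g h. g \<in> G \<and> h \<in> H}" (is "dense ?P")
proof -
  have fin: "finite G" "finite H" and sub: "G \<subseteq> R" "H \<subseteq> R"
    and nz: "rspan R G \<noteq> {0}" "rspan R H \<noteq> {0}"
    and star: "star (rspan R G) = star R" "star (rspan R H) = star R"
    using G H by (auto simp: dense_def)
  have nzG: "nz_submod R (rspan R G)" and nzH: "nz_submod R (rspan R H)"
    using sub nz subset_frac by (auto intro!: nz_submod_rspan)
  have one_star: "1 \<in> star R" using one star_extensive[OF nz_submod_self] by (rule rev_subsetD)
  have P: "?P \<subseteq> R" "?P \<subseteq> frac R" using sub mult subset_frac by blast+
  have "\<exists>g\<in>G. g \<noteq> 0" "\<exists>h\<in>H. h \<noteq> 0"
    using nz rspan_nonzero sub subset_frac by blast+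
  then obtain g0 h0 where "g0 \<in> G" "g0 \<noteq> 0" "h0 \<in> H" "h0 \<noteq> 0" by blast
  then have "g0 * h0 \<in> rspan R ?P" by (intro rspan_mem) blast
  moreover have "g0 * h0 \<noteq> 0" using \<open>g0 \<noteq> 0\<close> \<open>h0 \<noteq> 0\<close> by simp
  ultimately have nzP: "rspan R ?P \<noteq> {0}" by (metis singletonD)
  have nsP: "nz_submod R (rspan R ?P)" by (rule nz_submod_rspan[OF P(2) nzP])
  have "h \<in> star (rspan R ?P)" if h: "h \<in> H" for h
  \<comment> \<open>The scaling axiom covers nonzero factors only.\<close>
  proof (cases "h = 0")
    case True
    then show ?thesis using star_submod[OF nsP] by (simp add: submod_def)
  next
    case False
    have hf: "h \<in> frac R" using h sub subset_frac by auto
    have "h * g \<in> rspan R ?P" if "g \<in> G" for g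
      using that h mult.commute[of h g] by (intro rspan_mem) blast
    then have "rspan R G \<subseteq> {v \<in> frac R. h * v \<in> rspan R ?P}"
      using sub subset_frac
      by (intro rspan_least submod_preimage_mult submod_rspan P(2)) auto
    then have incl: "smul h (rspan R G) \<subseteq> rspan R ?P" by (auto simp: smul_def)
    have "submod R (smul h (rspan R G))"
      using nzG hf by (auto simp: nz_submod_def intro: submod_smul)
    moreover have "smul h (rspan R G) \<noteq> {0}"
    proof -
      have "h * g0 \<in> smul h (rspan R G)"
        unfolding smul_def using rspan_mem[OF \<open>g0 \<in> G\<close>] by blast
      moreover have "h * g0 \<noteq> 0" using \<open>g0 \<noteq> 0\<close> False by simp
      ultimately show ?thesis by (metis singletonD)
    qed
    ultimately have "nz_submod R (smul h (rspan R G))" by (simp add: nz_submod_def)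
    from star_mono[OF this nsP incl] have "smul h (star R) \<subseteq> star (rspan R ?P)"
      using star_smul[OF hf False nzG] star by simp
    then have "h * 1 \<in> star (rspan R ?P)"
      unfolding smul_def by (rule subsetD) (rule imageI[OF one_star])
    then show ?thesis by simp
  qed
  then have "rspan R H \<subseteq> star (rspan R ?P)"
    by (intro rspan_least star_submod[OF nsP]) auto
  from star_mono[OF nzH nz_submod_star[OF nsP] this] have "star R \<subseteq> star (rspan R ?P)"
    by (simp add: star star_idem[OF nsP])
  then have "1 \<in> star (rspan R ?P)" using one_star by (rule subsetD)
  moreover have "finite ?P"
    using fin by (intro finite_image_set2) simp_all
  ultimately show ?thesis by (rule denseI[OF _ P(1) nzP, rotated])
qed

section \<open>The closure operation given by dense sets\<close>

lemma mem_tilde: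
  assumes E: "submod R E"
  shows "x \<in> tilde E \<longleftrightarrow> x \<in> frac R \<and> (\<exists>G. dense G \<and> (\<forall>g\<in>G. x * g \<in> E))"
proof
  assume "x \<in> tilde E"
  then obtain G where "x \<in> frac R" "finite G" "G \<subseteq> R" "rspan R G \<noteq> {0}"
    "star (rspan R G) = star R" "smul x (rspan R G) \<subseteq> E"
    by (auto simp: star_tilde_def)
  then show "x \<in> frac R \<and> (\<exists>G. dense G \<and> (\<forall>g\<in>G. x * g \<in> E))"
    by (intro conjI exI[of _ G]) (auto simp: dense_def smul_def intro!: rspan_mem)
next
  assume "x \<in> frac R \<and> (\<exists>G. dense G \<and> (\<forall>g\<in>G. x * g \<in> E))"
  then obtain G where x: "x \<in> frac R" and G: "dense G" "\<forall>g\<in>G. x * g \<in> E" by blast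
  \<comment> \<open>The elements that \<open>x\<close> carries into \<open>E\<close> form a
    submodule, so the test on \<open>G\<close> extends to its ideal.\<close>
  have "rspan R G \<subseteq> {v \<in> frac R. x * v \<in> E}"
    using G subset_frac by (intro rspan_least submod_preimage_mult E) (auto simp: dense_def)
  then have "smul x (rspan R G) \<subseteq> E" by (auto simp: smul_def)
  then show "x \<in> tilde E" using x G(1)
    by (auto simp: star_tilde_def dense_def)
qed

text \<open>The dense sets of the individual elements are multiplied together; additional factors
  from \<open>R\<close> do no harm because \<open>E\<close> is a submodule.\<close>

lemma tilde_common_dense:
  assumes E: "submod R E" and "finite A" "A \<subseteq> tilde E"
  obtains D where "dense D" "\<And>x d. x \<in> A \<Longrightarrow> d \<in> D \<Longrightarrow> x * d \<in> E"
proof -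
  have "\<exists>D. dense D \<and> (\<forall>x\<in>A. \<forall>d\<in>D. x * d \<in> E)"
    using assms(2,3)
  proof (induction A rule: finite_induct)
    case empty
    then show ?case using dense_one by auto
  next
    case (insert a A)
    then obtain D where D: "dense D" "\<forall>x\<in>A. \<forall>d\<in>D. x * d \<in> E" by auto
    obtain G where G: "dense G" "\<forall>g\<in>G. a * g \<in> E"
      using insert.prems mem_tilde[OF E] by auto
    have "x * (d * g) \<in> E" if "x \<in> insert a A" "d \<in> D" "g \<in> G" for x d g
    proof -
      have R: "d \<in> R" "g \<in> R" using that D(1) G(1) by (auto simp: dense_def)
      show ?thesis
      proof (cases "x = a")
        case True
        then have "d * (x * g) \<in> E" using G(2) E R(1) that by (auto simp: submod_def)
        then show ?thesis by (simp add: mult.left_commute)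
      next
        case False
        then have "g * (x * d) \<in> E" using D(2) E R(2) that by (auto simp: submod_def)
        then show ?thesis by (simp add: mult_ac)
      qed
    qed
    then show ?case using dense_mult[OF D(1) G(1)] by blast
  qed
  then show ?thesis using that by blast
qed

lemma tilde_extensive: "submod R E \<Longrightarrow> E \<subseteq> tilde E"
  using dense_one by (auto simp: mem_tilde submod_def intro!: exI[of _ "{1}"])

lemma tilde_mono: "submod R E \<Longrightarrow> submod R F \<Longrightarrow> E \<subseteq> F \<Longrightarrow> tilde E \<subseteq> tilde F"
  unfolding subset_iff mem_tilde by blast

lemma submod_tilde:
  assumes E: "submod R E"
  shows "submod R (tilde E)"
  unfolding submod_def
proof (intro conjI ballI)
  show "tilde E \<subseteq> frac R" by (auto simp: star_tilde_def)
  show "0 \<in> tilde E" using tilde_extensive[OF E] E by (auto simp: submod_def)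
  show "x + y \<in> tilde E" if xy: "x \<in> tilde E" "y \<in> tilde E" for x y
  proof -
    obtain D where D: "dense D" "\<And>z d. z \<in> {x, y} \<Longrightarrow> d \<in> D \<Longrightarrow> z * d \<in> E"
      using tilde_common_dense[OF E, of "{x, y}"] xy by blast
    have "x + y \<in> frac R" using xy by (auto simp: star_tilde_def intro: frac_add)
    moreover have "(x + y) * d \<in> E" if "d \<in> D" for d
      using D(2)[of x d] D(2)[of y d] that E by (auto simp: distrib_right submod_def)
    ultimately show ?thesis using D(1) mem_tilde[OF E] by blast
  qed
  show "r * x \<in> tilde E" if r: "r \<in> R" and x: "x \<in> tilde E" for r x
  proof -
    obtain D where D: "dense D" "\<forall>d\<in>D. x * d \<in> E" using x mem_tilde[OF E] by blast
    have "r * x \<in> frac R" using x r subset_frac by (auto simp: star_tilde_def intro!: frac_mult)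
    moreover have "(r * x) * d \<in> E" if "d \<in> D" for d
      using D(2) that E r by (auto simp: mult.assoc submod_def)
    ultimately show ?thesis using D(1) mem_tilde[OF E] by blast
  qed
qed

text \<open>A single dense set \<open>D\<close> serves all the finitely many products
  \<open>z * g\<close>, and then the products \<open>g * d\<close> form a dense set for
  \<open>z\<close>. This allows membership in a closure to be tested after multiplication by a dense
  set.\<close>

lemma tilde_dense:
  assumes E: "submod R E" and z: "z \<in> frac R" and G: "dense G" "\<And>g. g \<in> G \<Longrightarrow> z * g \<in> tilde E"
  shows "z \<in> tilde E"
proof -
  have "finite ((*) z ` G)" "(*) z ` G \<subseteq> tilde E" using G by (auto simp: dense_def)
  then obtain D where D: "dense D" "\<And>x d. x \<in> (*) z ` G \<Longrightarrow> d \<in> D \<Longrightarrow> x * d \<in> E"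
    using tilde_common_dense[OF E] by blast
  have "z * (g * d) \<in> E" if "g \<in> G" "d \<in> D" for g d
    using D(2)[OF imageI[OF that(1)] that(2)] by (simp add: mult.assoc)
  then have "\<forall>x\<in>{g * d | g d. g \<in> G \<and> d \<in> D}. z * x \<in> E" by blast
  then show ?thesis using dense_mult[OF G(1) D(1)] z mem_tilde[OF E] by blast
qed

lemma tilde_idem:
  assumes E: "submod R E"
  shows "tilde (tilde E) = tilde E"
proof
  show "tilde (tilde E) \<subseteq> tilde E"
    using tilde_dense[OF E] by (auto simp: mem_tilde[OF submod_tilde[OF E]])
  show "tilde E \<subseteq> tilde (tilde E)" by (rule tilde_extensive[OF submod_tilde[OF E]])
qed

lemma tilde_subset_tilde:
  "submod R E \<Longrightarrow> submod R F \<Longrightarrow> E \<subseteq> tilde F \<Longrightarrow> tilde E \<subseteq> tilde F"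
  using tilde_mono[of E "tilde F"] submod_tilde tilde_idem by simp

text \<open>A dense set witnessing the last hypothesis consists of elements that \<open>r\<close>
  multiplies into \<open>M\<close>.\<close>

lemma tilde_unit_preimage:
  assumes M: "submod R M" and "r \<in> frac R" and "1 \<in> tilde {v \<in> frac R. r * v \<in> M}"
  shows "r \<in> tilde M"
  using assms mem_tilde[OF submod_preimage_mult[OF M]] mem_tilde[OF M] by auto

text \<open>Since \<open>star_f\<close> is a union over finitely generated submodules, 1 already
  lies in the closure of one of them. Its generators lie in the product of \<open>I\<close> with its
  inverse, hence in \<open>R\<close>, and form a dense set.\<close>

lemma star_f_invertible_iff:
  assumes I: "I \<subseteq> frac R"
  shows "star_f_invertible R star I \<longleftrightarrow> 1 \<in> tilde (mprod R I (colon R I))"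
proof -
  define M where "M = mprod R I (colon R I)"
  have M: "submod R M" "M \<subseteq> R"
    using submod_mprod[OF I colon_subset] colon_mprod_subset by (auto simp: M_def)
  have "star_f R star M = star R \<longleftrightarrow> 1 \<in> tilde M"
  proof
    assume "star_f R star M = star R"
    then have "1 \<in> star_f R star M" using one star_extensive[OF nz_submod_self] by auto
    then obtain F where F: "fg_frac_ideal R F" "F \<subseteq> M" "1 \<in> star F"
      by (auto simp: star_f_def)
    obtain G where G: "finite G" "G \<subseteq> frac R" "F = rspan R G" "F \<noteq> {0}"
      using F(1) by (auto simp: fg_frac_ideal_def)
    have "G \<subseteq> M" using F(2) G(3) rspan_mem by auto
    then have "dense G" using G F M(2) by (intro denseI) auto
    then show "1 \<in> tilde M"
      using \<open>G \<subseteq> M\<close> one subset_frac by (auto simp: mem_tilde[OF M(1)] intro!: exI[of _ G])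
  next
    assume "1 \<in> tilde M"
    then obtain G where G: "dense G" "G \<subseteq> M" by (auto simp: mem_tilde[OF M(1)])
    \<comment> \<open>Every member of the union is bounded by \<open>star R\<close>, because
      \<open>M\<close> lies in \<open>R\<close>.\<close>
    have sub: "star F \<subseteq> star R" if "fg_frac_ideal R F" "F \<subseteq> M" for F
    proof -
      have "nz_submod R F"
        using that(1) by (auto simp: fg_frac_ideal_def intro!: nz_submod_rspan)
      then show ?thesis using star_mono nz_submod_self that(2) M(2) by blast
    qed
    have "fg_frac_ideal R (rspan R G)"
      unfolding fg_frac_ideal_def
      by (intro conjI exI[of _ G]) (use G(1) subset_frac in \<open>auto simp: dense_def\<close>)
    moreover have "rspan R G \<subseteq> M" by (rule rspan_least[OF M(1) G(2)])
    moreover have "star (rspan R G) = star R" using G(1) by (simp add: dense_def)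
    ultimately have "star R \<subseteq> star_f R star M" unfolding star_f_def by blast
    with sub show "star_f R star M = star R" by (auto simp: star_f_def)
  qed
  then show ?thesis by (simp add: star_f_invertible_def M_def)
qed

end

section \<open>Homogeneous components\<close>

locale graded = field_subring R for R :: "'k::field set" +
  fixes \<Gamma> :: "'g::ab_group_add set" and Rg :: "'g \<Rightarrow> 'k set"
  assumes graded: "graded_domain \<Gamma> Rg R"
begin

section \<open>Degrees and homogeneous elements of the ring\<close>

lemma degree_zero_mem: "0 \<in> \<Gamma>"
  and degree_add: "\<alpha> \<in> \<Gamma> \<Longrightarrow> \<beta> \<in> \<Gamma> \<Longrightarrow> \<alpha> + \<beta> \<in> \<Gamma>"
  using graded by (simp_all add: graded_domain_def)

lemma Rg_subset: "\<alpha> \<in> \<Gamma> \<Longrightarrow> Rg \<alpha> \<subseteq> R"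
  and Rg_add: "\<alpha> \<in> \<Gamma> \<Longrightarrow> x \<in> Rg \<alpha> \<Longrightarrow> y \<in> Rg \<alpha> \<Longrightarrow> x + y \<in> Rg \<alpha>"
  and Rg_uminus: "\<alpha> \<in> \<Gamma> \<Longrightarrow> x \<in> Rg \<alpha> \<Longrightarrow> - x \<in> Rg \<alpha>"
  using graded by (simp_all add: graded_domain_def)

lemma Rg_mult:
  assumes "\<alpha> \<in> \<Gamma>" "\<beta> \<in> \<Gamma>" "x \<in> Rg \<alpha>" "y \<in> Rg \<beta>"
  shows "x * y \<in> Rg (\<alpha> + \<beta>)"
proof -
  have "\<forall>\<alpha>\<in>\<Gamma>. \<forall>\<beta>\<in>\<Gamma>. \<forall>x\<in>Rg \<alpha>. \<forall>y\<in>Rg \<beta>. x * y \<in> Rg (\<alpha> + \<beta>)"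
    using graded unfolding graded_domain_def by (elim conjE)
  then show ?thesis using assms by blast
qed

lemma Rg_decomposition:
  assumes "x \<in> R"
  obtains S c where "finite S" "S \<subseteq> \<Gamma>" "\<And>\<alpha>. \<alpha> \<in> S \<Longrightarrow> c \<alpha> \<in> Rg \<alpha>" "x = (\<Sum>\<alpha>\<in>S. c \<alpha>)"
proof -
  have "\<forall>x\<in>R. \<exists>S c. finite S \<and> S \<subseteq> \<Gamma> \<and> (\<forall>\<alpha>\<in>S. c \<alpha> \<in> Rg \<alpha>) \<and> x = (\<Sum>\<alpha>\<in>S. c \<alpha>)"
    using graded unfolding graded_domain_def by (elim conjE)
  then show ?thesis using that assms by metis
qed

lemma Rg_independent:
  assumes "finite S" "S \<subseteq> \<Gamma>" "\<And>\<alpha>. \<alpha> \<in> S \<Longrightarrow> c \<alpha> \<in> Rg \<alpha>" "(\<Sum>\<alpha>\<in>S. c \<alpha>) = 0" "\<alpha> \<in> S"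
  shows "c \<alpha> = 0"
proof -
  have "\<forall>S c. finite S \<and> S \<subseteq> \<Gamma> \<and> (\<forall>\<alpha>\<in>S. c \<alpha> \<in> Rg \<alpha>) \<and> (\<Sum>\<alpha>\<in>S. c \<alpha>) = 0
        \<longrightarrow> (\<forall>\<alpha>\<in>S. c \<alpha> = 0)"
    using graded unfolding graded_domain_def by (elim conjE)
  then show ?thesis using assms by blast
qed

lemma torsion_free_quot_group: "torsion_free_subgroup (quot_group \<Gamma>)"
proof
  show "0 \<in> quot_group \<Gamma>"
    using degree_zero_mem unfolding quot_group_def by force
  show "x - y \<in> quot_group \<Gamma>" if xy: "x \<in> quot_group \<Gamma>" "y \<in> quot_group \<Gamma>" for x y
  proof -
    obtain a b c d where "x = a - b" "y = c - d" "a \<in> \<Gamma>" "b \<in> \<Gamma>" "c \<in> \<Gamma>" "d \<in> \<Gamma>"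
      using xy unfolding quot_group_def by blast
    then have "x - y = (a + d) - (b + c)" "a + d \<in> \<Gamma>" "b + c \<in> \<Gamma>"
      by (simp_all add: degree_add algebra_simps)
    then show ?thesis unfolding quot_group_def by blast
  qed
  have "\<forall>n::nat. \<forall>x\<in>quot_group \<Gamma>. n > 0 \<and> (\<Sum>i<n. x) = 0 \<longrightarrow> x = 0"
    using graded unfolding graded_domain_def by (elim conjE)
  then show "x = 0" if "x \<in> quot_group \<Gamma>" "n > 0" "(\<Sum>i<n. x) = 0" for n :: nat and x
    using that by blast
qed

text \<open>The pairs of a degree and a power of X index the homogeneous terms of polynomials; this
  supplies the condition on exponents in \<open>dedekind_mertens\<close>.\<close>

lemma unique_sums_quot_group: "unique_sums (quot_group \<Gamma> \<times> (UNIV :: nat set))"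
  unfolding unique_sums_def
proof (intro allI impI, elim conjE)
  fix A B :: "('g \<times> nat) set"
  assume AB: "finite A" "A \<noteq> {}" "A \<subseteq> quot_group \<Gamma> \<times> UNIV"
    "finite B" "B \<noteq> {}" "B \<subseteq> quot_group \<Gamma> \<times> UNIV"
  then have "fst ` A \<subseteq> quot_group \<Gamma>" "fst ` B \<subseteq> quot_group \<Gamma>" by auto
  then obtain a b where "a \<in> A" "b \<in> B"
    "\<And>a' b'. a' \<in> A \<Longrightarrow> b' \<in> B \<Longrightarrow> a' + b' = a + b \<Longrightarrow> a' = a \<and> b' = b"
    using torsion_free_subgroup.unique_sum_Times_nat[OF torsion_free_quot_group AB(1,2) _ AB(4,5)]
    by metis
  then show "\<exists>a\<in>A. \<exists>b\<in>B. \<forall>a'\<in>A. \<forall>b'\<in>B. a' + b' = a + b \<longrightarrow> a' = a \<and> b' = b" by blast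
qed

lemma homogE:
  assumes "h \<in> homog \<Gamma> Rg"
  obtains \<alpha> where "\<alpha> \<in> \<Gamma>" "h \<in> Rg \<alpha>" "h \<noteq> 0"
  using assms by (auto simp: homog_def)

lemma homogI: "\<alpha> \<in> \<Gamma> \<Longrightarrow> h \<in> Rg \<alpha> \<Longrightarrow> h \<noteq> 0 \<Longrightarrow> h \<in> homog \<Gamma> Rg"
  by (auto simp: homog_def)

lemma homog_subset: "homog \<Gamma> Rg \<subseteq> R"
  using Rg_subset by (auto simp: homog_def)

lemma homog_mult: "g \<in> homog \<Gamma> Rg \<Longrightarrow> h \<in> homog \<Gamma> Rg \<Longrightarrow> g * h \<in> homog \<Gamma> Rg"
  by (elim homogE, rule homogI[OF degree_add Rg_mult]) auto

lemma homog_uminus: "h \<in> homog \<Gamma> Rg \<Longrightarrow> - h \<in> homog \<Gamma> Rg"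
  by (elim homogE, rule homogI[OF _ Rg_uminus]) auto

text \<open>Some component of 1 is nonzero. This supplies an auxiliary denominator without using
  that 1 itself is homogeneous.\<close>

lemma homog_exists: "\<exists>h. h \<in> homog \<Gamma> Rg"
proof -
  obtain S c where S: "finite S" "S \<subseteq> \<Gamma>" "\<And>\<alpha>. \<alpha> \<in> S \<Longrightarrow> c \<alpha> \<in> Rg \<alpha>" "1 = (\<Sum>\<alpha>\<in>S. c \<alpha>)"
    using Rg_decomposition[OF one] by blast
  then obtain \<alpha> where "\<alpha> \<in> S" "c \<alpha> \<noteq> 0" by (metis sum.neutral zero_neq_one)
  then show ?thesis using S homogI by blast
qed

section \<open>Homogeneous components in the homogeneous quotient field\<close>

abbreviation comp :: "'g \<Rightarrow> 'k set" where
  "comp \<equiv> RH_comp \<Gamma> Rg"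

lemma compI:
  "\<alpha> \<in> \<Gamma> \<Longrightarrow> \<beta> \<in> \<Gamma> \<Longrightarrow> r \<in> Rg \<alpha> \<Longrightarrow> h \<in> Rg \<beta> \<Longrightarrow> h \<noteq> 0 \<Longrightarrow> \<alpha> - \<beta> = \<delta> \<Longrightarrow> r / h \<in> comp \<delta>"
  unfolding RH_comp_def by blast

lemma compE:
  assumes "x \<in> comp \<delta>"
  obtains r h \<alpha> \<beta> where "x = r / h" "\<alpha> \<in> \<Gamma>" "\<beta> \<in> \<Gamma>" "r \<in> Rg \<alpha>" "h \<in> Rg \<beta>" "h \<noteq> 0" "\<alpha> - \<beta> = \<delta>"
  using assms unfolding RH_comp_def by blast

lemma comp_mult:
  assumes "x \<in> comp \<delta>" "y \<in> comp \<epsilon>"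
  shows "x * y \<in> comp (\<delta> + \<epsilon>)"
proof -
  obtain r h \<alpha> \<beta> where x: "x = r / h" "\<alpha> \<in> \<Gamma>" "\<beta> \<in> \<Gamma>" "r \<in> Rg \<alpha>" "h \<in> Rg \<beta>" "h \<noteq> 0" "\<alpha> - \<beta> = \<delta>"
    using assms(1) by (rule compE)
  obtain r' h' \<alpha>' \<beta>' where y: "y = r' / h'" "\<alpha>' \<in> \<Gamma>" "\<beta>' \<in> \<Gamma>" "r' \<in> Rg \<alpha>'" "h' \<in> Rg \<beta>'" "h' \<noteq> 0" "\<alpha>' - \<beta>' = \<epsilon>"
    using assms(2) by (rule compE)
  have "h * h' \<noteq> 0" using x(6) y(6) by simp
  moreover have "(\<alpha> + \<alpha>') - (\<beta> + \<beta>') = \<delta> + \<epsilon>"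
    unfolding x(7)[symmetric] y(7)[symmetric] by (rule add_diff_add)
  ultimately have "(r * r') / (h * h') \<in> comp (\<delta> + \<epsilon>)"
    by (rule compI[OF degree_add[OF x(2) y(2)] degree_add[OF x(3) y(3)]
          Rg_mult[OF x(2) y(2) x(4) y(4)] Rg_mult[OF x(3) y(3) x(5) y(5)]])
  then show ?thesis by (simp add: x(1) y(1))
qed

lemma comp_add:
  assumes "x \<in> comp \<delta>" "y \<in> comp \<delta>"
  shows "x + y \<in> comp \<delta>"
proof -
  obtain r h \<alpha> \<beta> where x: "x = r / h" "\<alpha> \<in> \<Gamma>" "\<beta> \<in> \<Gamma>" "r \<in> Rg \<alpha>" "h \<in> Rg \<beta>" "h \<noteq> 0" "\<alpha> - \<beta> = \<delta>"
    using assms(1) by (rule compE)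
  obtain r' h' \<alpha>' \<beta>' where y: "y = r' / h'" "\<alpha>' \<in> \<Gamma>" "\<beta>' \<in> \<Gamma>" "r' \<in> Rg \<alpha>'" "h' \<in> Rg \<beta>'" "h' \<noteq> 0" "\<alpha>' - \<beta>' = \<delta>"
    using assms(2) by (rule compE)
  \<comment> \<open>Over the common denominator \<open>h * h'\<close> the two numerators have the
    same degree because both fractions have degree \<delta>.\<close>
  have "\<alpha> = \<delta> + \<beta>" "\<alpha>' = \<delta> + \<beta>'" using x(7) y(7) by (simp_all add: diff_eq_eq)
  then have deg: "\<alpha>' + \<beta> = \<alpha> + \<beta>'" by (simp only: add_ac)
  have "r * h' \<in> Rg (\<alpha> + \<beta>')" by (rule Rg_mult[OF x(2) y(3) x(4) y(5)])
  moreover have "r' * h \<in> Rg (\<alpha> + \<beta>')"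
    unfolding deg[symmetric] by (rule Rg_mult[OF y(2) x(3) y(4) x(5)])
  ultimately have "r * h' + r' * h \<in> Rg (\<alpha> + \<beta>')"
    by (rule Rg_add[OF degree_add[OF x(2) y(3)]])
  moreover have "h * h' \<in> Rg (\<beta> + \<beta>')" by (rule Rg_mult[OF x(3) y(3) x(5) y(5)])
  moreover have "h * h' \<noteq> 0" using x(6) y(6) by simp
  moreover have "\<alpha> + \<beta>' - (\<beta> + \<beta>') = \<delta>" using x(7) by simp
  ultimately have "(r * h' + r' * h) / (h * h') \<in> comp \<delta>"
    by (rule compI[OF degree_add[OF x(2) y(3)] degree_add[OF x(3) y(3)]])
  then show ?thesis unfolding x(1) y(1) add_frac_eq[OF x(6) y(6)] .
qed

lemma comp_uminus:
  assumes "x \<in> comp \<delta>"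
  shows "- x \<in> comp \<delta>"
proof -
  obtain r h \<alpha> \<beta> where x: "x = r / h" "\<alpha> \<in> \<Gamma>" "\<beta> \<in> \<Gamma>" "r \<in> Rg \<alpha>" "h \<in> Rg \<beta>" "h \<noteq> 0" "\<alpha> - \<beta> = \<delta>"
    using assms by (rule compE)
  have "(- r) / h \<in> comp \<delta>"
    by (rule compI[OF x(2,3) Rg_uminus[OF x(2,4)] x(5-7)])
  then show ?thesis by (simp add: x(1))
qed

lemma Rg_subset_comp:
  assumes "\<alpha> \<in> \<Gamma>" "r \<in> Rg \<alpha>"
  shows "r \<in> comp \<alpha>"
proof -
  obtain h where "h \<in> homog \<Gamma> Rg" using homog_exists by blast
  then obtain \<beta> where h: "\<beta> \<in> \<Gamma>" "h \<in> Rg \<beta>" "h \<noteq> 0" by (rule homogE)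
  have "(r * h) / h \<in> comp \<alpha>"
    by (rule compI[OF degree_add[OF assms(1) h(1)] h(1) Rg_mult[OF assms(1) h(1) assms(2) h(2)] h(2,3)])
       simp
  then show ?thesis using h by simp
qed

lemma comp_quot_group: "x \<in> comp \<delta> \<Longrightarrow> \<delta> \<in> quot_group \<Gamma>"
  unfolding quot_group_def by (elim compE) blast

text \<open>\<open>comp \<delta>\<close> is empty when no quotient of nonzero homogeneous elements has degree \<open>\<delta>\<close>.\<close>

definition comp0 :: "'g \<Rightarrow> 'k set" where
  "comp0 \<delta> = insert 0 (comp \<delta>)"

lemma comp0_zero: "0 \<in> comp0 \<delta>" by (simp add: comp0_def)

lemma comp0_add: "x \<in> comp0 \<delta> \<Longrightarrow> y \<in> comp0 \<delta> \<Longrightarrow> x + y \<in> comp0 \<delta>"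
  using comp_add by (auto simp: comp0_def)

lemma comp0_diff: "x \<in> comp0 \<delta> \<Longrightarrow> y \<in> comp0 \<delta> \<Longrightarrow> x - y \<in> comp0 \<delta>"
  using comp0_add[of x \<delta> "- y"] comp_uminus by (auto simp: comp0_def)

lemma comp0_mult: "x \<in> comp0 \<delta> \<Longrightarrow> y \<in> comp0 \<epsilon> \<Longrightarrow> x * y \<in> comp0 (\<delta> + \<epsilon>)"
  using comp_mult by (auto simp: comp0_def)

lemma comp0_sum: "(\<And>i. i \<in> A \<Longrightarrow> f i \<in> comp0 \<delta>) \<Longrightarrow> sum f A \<in> comp0 \<delta>"
  by (induction A rule: infinite_finite_induct) (auto intro: comp0_zero comp0_add)

text \<open>Denominators are multiplied in one at a time, each shifting the degrees already treated.
  The index is kept apart from the degree \<open>d i\<close>, so that several elements may share a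
  degree.\<close>

lemma common_denominator:
  assumes "finite A" "\<And>i. i \<in> A \<Longrightarrow> c i \<in> comp (d i)"
  obtains \<beta> h where "\<beta> \<in> \<Gamma>" "h \<in> Rg \<beta>" "h \<noteq> 0"
    "\<And>i. i \<in> A \<Longrightarrow> \<beta> + d i \<in> \<Gamma> \<and> h * c i \<in> Rg (\<beta> + d i)"
proof -
  have "\<exists>\<beta>\<in>\<Gamma>. \<exists>h\<in>Rg \<beta>. h \<noteq> 0 \<and> (\<forall>i\<in>A. \<beta> + d i \<in> \<Gamma> \<and> h * c i \<in> Rg (\<beta> + d i))"
    using assms
  proof (induction A rule: finite_induct)
    case empty
    obtain h where "h \<in> homog \<Gamma> Rg" using homog_exists by blast
    then obtain \<beta> where "\<beta> \<in> \<Gamma>" "h \<in> Rg \<beta>" "h \<noteq> 0" by (rule homogE)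
    then show ?case by blast
  next
    case (insert i A)
    then obtain \<beta> h where h: "\<beta> \<in> \<Gamma>" "h \<in> Rg \<beta>" "h \<noteq> 0"
      "\<forall>i\<in>A. \<beta> + d i \<in> \<Gamma> \<and> h * c i \<in> Rg (\<beta> + d i)" by blast
    obtain r g \<alpha> \<beta>' where g: "c i = r / g" "\<alpha> \<in> \<Gamma>" "\<beta>' \<in> \<Gamma>" "r \<in> Rg \<alpha>" "g \<in> Rg \<beta>'" "g \<noteq> 0" "\<alpha> - \<beta>' = d i"
      using insert.prems[of i] by (auto elim: compE)
    have "\<beta> + \<beta>' + d j \<in> \<Gamma> \<and> (h * g) * c j \<in> Rg (\<beta> + \<beta>' + d j)" if "j \<in> insert i A" for j
    proof (cases "j = i")
      case True
      have deg: "\<beta> + \<beta>' + d j = \<beta> + \<alpha>" by (simp add: True flip: g(7))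
      have prod: "(h * g) * c j = h * r" using g(6) by (simp add: True g(1))
      show ?thesis
        unfolding deg prod using degree_add[OF h(1) g(2)] Rg_mult[OF h(1) g(2) h(2) g(4)] by blast
    next
      case False
      then have j: "\<beta> + d j \<in> \<Gamma>" "h * c j \<in> Rg (\<beta> + d j)" using h that by auto
      have "(h * c j) * g \<in> Rg ((\<beta> + d j) + \<beta>')" "(\<beta> + d j) + \<beta>' \<in> \<Gamma>"
        using j g by (auto intro: degree_add Rg_mult)
      moreover have "\<beta> + \<beta>' + d j = (\<beta> + d j) + \<beta>'" "(h * g) * c j = (h * c j) * g"
        by (simp_all add: add_ac mult_ac)
      ultimately show ?thesis by metis
    qed
    moreover have "\<beta> + \<beta>' \<in> \<Gamma>" "h * g \<in> Rg (\<beta> + \<beta>')" "h * g \<noteq> 0"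
      using g h by (auto intro: degree_add Rg_mult)
    ultimately show ?case by blast
  qed
  then show ?thesis using that by blast
qed

text \<open>Clearing denominators by one homogeneous element shifts all degrees by \<beta> and
  reduces the claim to independence of the graded pieces of \<open>R\<close>.\<close>

lemma comp0_independent:
  assumes "finite S" "\<And>\<delta>. \<delta> \<in> S \<Longrightarrow> c \<delta> \<in> comp0 \<delta>" "(\<Sum>\<delta>\<in>S. c \<delta>) = 0" "\<delta> \<in> S"
  shows "c \<delta> = 0"
proof (rule ccontr)
  assume nz: "c \<delta> \<noteq> 0"
  \<comment> \<open>Zero entries are discarded: they lie in \<open>comp0\<close> but perhaps not in
    \<open>comp\<close>, which \<open>common_denominator\<close> requires.\<close>
  define T where "T = {\<delta> \<in> S. c \<delta> \<noteq> 0}"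
  have T: "finite T" "\<And>\<delta>. \<delta> \<in> T \<Longrightarrow> c \<delta> \<in> comp \<delta>"
    using assms(1,2) by (auto simp: T_def comp0_def)
  obtain \<beta> h where h: "\<beta> \<in> \<Gamma>" "h \<in> Rg \<beta>" "h \<noteq> 0"
    "\<And>\<delta>. \<delta> \<in> T \<Longrightarrow> \<beta> + \<delta> \<in> \<Gamma> \<and> h * c \<delta> \<in> Rg (\<beta> + \<delta>)"
    using common_denominator[of T c "\<lambda>\<delta>. \<delta>"] T by blast
  have "sum c S = sum c T" by (rule sum.mono_neutral_right[OF assms(1)]) (auto simp: T_def)
  then have "(\<Sum>\<delta>\<in>T. c \<delta>) = 0" using assms(3) by simp
  then have "(\<Sum>\<delta>\<in>T. h * c \<delta>) = 0" by (simp add: sum_distrib_left[symmetric])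
  then have "(\<Sum>\<gamma>\<in>(+) \<beta> ` T. h * c (\<gamma> - \<beta>)) = 0"
    by (subst sum.reindex) (simp_all add: inj_on_def)
  moreover have "finite ((+) \<beta> ` T)" "(+) \<beta> ` T \<subseteq> \<Gamma>" using T(1) h(4) by auto
  moreover have "h * c (\<gamma> - \<beta>) \<in> Rg \<gamma>" if "\<gamma> \<in> (+) \<beta> ` T" for \<gamma>
    using that h(4) by auto
  moreover have "\<beta> + \<delta> \<in> (+) \<beta> ` T" using nz assms(4) by (simp add: T_def)
  ultimately have "h * c (\<beta> + \<delta> - \<beta>) = 0"
    using Rg_independent[of "(+) \<beta> ` T" "\<lambda>\<gamma>. h * c (\<gamma> - \<beta>)"] by blast
  then show False using h(3) nz by simp
qed

text \<open>Since \<open>hcomps\<close> is a definite description, this is where decompositions are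
  shown to be unique: the difference of two of them is a relation that independence kills.\<close>

lemma hcomps_eqI:
  assumes "finite A" "\<And>\<delta>. \<delta> \<in> A \<Longrightarrow> c \<delta> \<in> comp0 \<delta>" "\<And>\<delta>. \<delta> \<notin> A \<Longrightarrow> c \<delta> = 0"
    and "a = (\<Sum>\<delta>\<in>A. c \<delta>)"
  shows "hcomps \<Gamma> Rg a = c"
  unfolding hcomps_def
proof (rule the_equality)
  have supp: "{\<delta>. c \<delta> \<noteq> 0} \<subseteq> A" using assms(3) by blast
  have "a = (\<Sum>\<delta>\<in>{\<delta>. c \<delta> \<noteq> 0}. c \<delta>)"
    unfolding assms(4) by (rule sum.mono_neutral_right[OF assms(1) supp]) auto
  moreover have "finite {\<delta>. c \<delta> \<noteq> 0}" by (rule finite_subset[OF supp assms(1)])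
  moreover have "\<forall>\<delta>. c \<delta> \<noteq> 0 \<longrightarrow> c \<delta> \<in> comp \<delta>"
    using assms(2) supp by (auto simp: comp0_def)
  ultimately show "finite {\<delta>. c \<delta> \<noteq> 0} \<and> (\<forall>\<delta>. c \<delta> \<noteq> 0 \<longrightarrow> c \<delta> \<in> comp \<delta>) \<and> a = (\<Sum>\<delta>\<in>{\<delta>. c \<delta> \<noteq> 0}. c \<delta>)"
    by blast
next
  fix e
  assume e: "finite {\<delta>. e \<delta> \<noteq> 0} \<and> (\<forall>\<delta>. e \<delta> \<noteq> 0 \<longrightarrow> e \<delta> \<in> comp \<delta>) \<and> a = (\<Sum>\<delta>\<in>{\<delta>. e \<delta> \<noteq> 0}. e \<delta>)"
  \<comment> \<open>A common index set on which both families can be summed and subtracted.\<close>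
  define B where "B = A \<union> {\<delta>. e \<delta> \<noteq> 0}"
  have B: "finite B" using assms(1) e by (simp add: B_def)
  have "a = sum c B"
    unfolding assms(4) B_def using assms(1,3) e by (intro sum.mono_neutral_left) auto
  moreover have "(\<Sum>\<delta>\<in>{\<delta>. e \<delta> \<noteq> 0}. e \<delta>) = sum e B"
    by (rule sum.mono_neutral_left[OF B]) (auto simp: B_def)
  ultimately have sum0: "(\<Sum>\<delta>\<in>B. e \<delta> - c \<delta>) = 0" using e by (simp add: sum_subtractf)
  have "e \<delta> - c \<delta> \<in> comp0 \<delta>" for \<delta>
  proof (rule comp0_diff)
    show "e \<delta> \<in> comp0 \<delta>" using e by (auto simp: comp0_def)
    show "c \<delta> \<in> comp0 \<delta>" using assms(2,3) comp0_zero by metis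
  qed
  then have B0: "e \<delta> - c \<delta> = 0" if "\<delta> \<in> B" for \<delta>
    by (rule comp0_independent[OF B _ sum0 that])
  show "e = c"
  proof
    show "e \<delta> = c \<delta>" for \<delta>
      using B0[of \<delta>] assms(3)[of \<delta>] by (cases "\<delta> \<in> B") (auto simp: B_def)
  qed
qed

text \<open>The components of a fraction are those of its numerator divided by the homogeneous
  denominator, with degrees lowered by \<beta>.\<close>

lemma RH_decomposition:
  assumes "a \<in> RH \<Gamma> Rg R"
  shows "finite {\<delta>. hcomps \<Gamma> Rg a \<delta> \<noteq> 0}" "hcomps \<Gamma> Rg a \<delta> \<in> comp0 \<delta>"
    "a = (\<Sum>\<delta>\<in>{\<delta>. hcomps \<Gamma> Rg a \<delta> \<noteq> 0}. hcomps \<Gamma> Rg a \<delta>)"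
proof -
  obtain x h where xh: "a = x / h" "x \<in> R" "h \<in> homog \<Gamma> Rg"
    using assms by (auto simp: RH_def)
  obtain \<beta> where h: "\<beta> \<in> \<Gamma>" "h \<in> Rg \<beta>" "h \<noteq> 0" using xh(3) by (rule homogE)
  obtain S c where S: "finite S" "S \<subseteq> \<Gamma>" "\<And>\<alpha>. \<alpha> \<in> S \<Longrightarrow> c \<alpha> \<in> Rg \<alpha>" "x = (\<Sum>\<alpha>\<in>S. c \<alpha>)"
    using Rg_decomposition[OF xh(2)] by blast
  define A where "A = (\<lambda>\<alpha>. \<alpha> - \<beta>) ` S"
  define e where "e \<delta> = (if \<delta> + \<beta> \<in> S then c (\<delta> + \<beta>) / h else 0)" for \<delta>
  have A: "finite A" using S(1) by (simp add: A_def)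
  have eA: "e \<delta> = 0" if "\<delta> \<notin> A" for \<delta>
    using that by (auto simp: A_def e_def image_iff eq_diff_eq)
  have e: "e \<delta> \<in> comp0 \<delta>" for \<delta>
  proof (cases "\<delta> + \<beta> \<in> S")
    case True
    then have "c (\<delta> + \<beta>) / h \<in> comp \<delta>"
      by (intro compI[OF _ h(1) S(3) h(2,3)] subsetD[OF S(2)]) simp_all
    then show ?thesis by (simp add: e_def comp0_def)
  qed (simp add: e_def comp0_def)
  have "sum e A = (\<Sum>\<alpha>\<in>S. c \<alpha> / h)"
    unfolding A_def by (subst sum.reindex) (auto simp: inj_on_def e_def)
  also have "\<dots> = a" by (simp add: xh(1) S(4) sum_divide_distrib)
  finally have ae: "a = sum e A" ..
  have eq: "hcomps \<Gamma> Rg a = e" by (rule hcomps_eqI[OF A e eA ae])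
  have supp: "{\<delta>. e \<delta> \<noteq> 0} \<subseteq> A" using eA by blast
  show "finite {\<delta>. hcomps \<Gamma> Rg a \<delta> \<noteq> 0}"
    unfolding eq by (rule finite_subset[OF supp A])
  show "hcomps \<Gamma> Rg a \<delta> \<in> comp0 \<delta>" unfolding eq by (rule e)
  show "a = (\<Sum>\<delta>\<in>{\<delta>. hcomps \<Gamma> Rg a \<delta> \<noteq> 0}. hcomps \<Gamma> Rg a \<delta>)"
    unfolding eq by (subst ae, rule sum.mono_neutral_right[OF A supp]) blast
qed

lemma hcomps_homogeneous:
  "x \<in> comp \<delta> \<Longrightarrow> hcomps \<Gamma> Rg x = (\<lambda>\<epsilon>. if \<epsilon> = \<delta> then x else 0)"
  by (rule hcomps_eqI[of "{\<delta>}"]) (simp_all add: comp0_def)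

lemma hcomps_zero: "hcomps \<Gamma> Rg 0 = (\<lambda>_. 0)"
  by (rule hcomps_eqI[of "{}"]) auto

lemma compset_homogeneous: "x \<in> comp \<delta> \<Longrightarrow> compset \<Gamma> Rg x = {x} - {0}"
  by (auto simp: compset_def hcomps_homogeneous)

lemma compset_zero: "compset \<Gamma> Rg 0 = {}"
  by (simp add: compset_def hcomps_zero)

lemma compset_homog: "x \<in> homog \<Gamma> Rg \<Longrightarrow> compset \<Gamma> Rg x = {x}"
  using compset_homogeneous[OF Rg_subset_comp] by (elim homogE) fastforce

text \<open>A decomposition in \<open>R\<close> is also one in the homogeneous quotient field, so by
  uniqueness the components agree.\<close>

lemma compset_subset_ring:
  assumes "x \<in> R"
  shows "compset \<Gamma> Rg x \<subseteq> R"
proof -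
  obtain S c where S: "finite S" "S \<subseteq> \<Gamma>" "\<And>\<alpha>. \<alpha> \<in> S \<Longrightarrow> c \<alpha> \<in> Rg \<alpha>" "x = (\<Sum>\<alpha>\<in>S. c \<alpha>)"
    using Rg_decomposition[OF assms] by blast
  have "hcomps \<Gamma> Rg x = (\<lambda>\<alpha>. if \<alpha> \<in> S then c \<alpha> else 0)"
    using S Rg_subset_comp by (intro hcomps_eqI[of S]) (auto simp: comp0_def)
  then have "compset \<Gamma> Rg x \<subseteq> c ` S" by (auto simp: compset_def)
  also have "\<dots> \<subseteq> R" using S(2,3) Rg_subset by blast
  finally show ?thesis .
qed

lemma RH_subset_frac: "RH \<Gamma> Rg R \<subseteq> frac R"
proof
  fix x assume "x \<in> RH \<Gamma> Rg R"
  then obtain a h where "x = a / h" "a \<in> R" "h \<in> homog \<Gamma> Rg" by (auto simp: RH_def)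
  then show "x \<in> frac R" using fracI homogE homog_subset by (metis subsetD)
qed

lemma ring_subset_RH: "R \<subseteq> RH \<Gamma> Rg R"
proof
  fix x assume x: "x \<in> R"
  obtain h where h: "h \<in> homog \<Gamma> Rg" using homog_exists by blast
  then have "h \<in> R" "h \<noteq> 0" using homog_subset by (auto simp: homog_def)
  then have "x = (x * h) / h" "x * h \<in> R" using mult[OF x] by simp_all
  then show "x \<in> RH \<Gamma> Rg R" using h unfolding RH_def by blast
qed

lemma comp_subset_RH: "comp \<delta> \<subseteq> RH \<Gamma> Rg R"
proof
  fix x assume "x \<in> comp \<delta>"
  then obtain r h \<alpha> \<beta> where x: "x = r / h" "\<alpha> \<in> \<Gamma>" "\<beta> \<in> \<Gamma>" "r \<in> Rg \<alpha>" "h \<in> Rg \<beta>" "h \<noteq> 0"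
    by (rule compE)
  then have "r \<in> R" "h \<in> homog \<Gamma> Rg" using Rg_subset homogI by blast+
  then show "x \<in> RH \<Gamma> Rg R" unfolding RH_def x(1) by blast
qed

lemma comp0_subset_frac: "comp0 \<delta> \<subseteq> frac R"
  using comp_subset_RH RH_subset_frac subset_frac zero by (auto simp: comp0_def)

lemma RH_diff:
  assumes "x \<in> RH \<Gamma> Rg R" "y \<in> RH \<Gamma> Rg R"
  shows "x - y \<in> RH \<Gamma> Rg R"
proof -
  obtain a g where x: "x = a / g" "a \<in> R" "g \<in> homog \<Gamma> Rg"
    using assms(1) by (auto simp: RH_def)
  obtain b h where y: "y = b / h" "b \<in> R" "h \<in> homog \<Gamma> Rg"
    using assms(2) by (auto simp: RH_def)
  have "g \<noteq> 0" "h \<noteq> 0" "g \<in> R" "h \<in> R" using x(3) y(3) homog_subset by (auto simp: homog_def)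
  then have "x - y = (a * h - b * g) / (g * h)" "a * h - b * g \<in> R"
    unfolding x(1) y(1) using x(2) y(2) by (auto simp: diff_frac_eq intro: diff mult)
  then show ?thesis
    unfolding RH_def using homog_mult[OF x(3) y(3)] by blast
qed

lemma compset_subset_frac: "a \<in> RH \<Gamma> Rg R \<Longrightarrow> compset \<Gamma> Rg a \<subseteq> frac R"
  using RH_decomposition(2) comp0_subset_frac by (force simp: compset_def)

lemma mem_rspan_compset:
  assumes a: "a \<in> RH \<Gamma> Rg R"
  shows "a \<in> rspan R (compset \<Gamma> Rg a)"
proof -
  have "(\<Sum>\<delta>\<in>{\<delta>. hcomps \<Gamma> Rg a \<delta> \<noteq> 0}. hcomps \<Gamma> Rg a \<delta>) \<in> rspan R (compset \<Gamma> Rg a)"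
    by (intro submod_sum[OF submod_rspan] compset_subset_frac a rspan_mem) (auto simp: compset_def)
  then show ?thesis by (simp flip: RH_decomposition(3)[OF a])
qed

end

section \<open>Homogeneous components of polynomials\<close>

text \<open>The first index coordinate is a degree in the grading and is forgotten; the second is
  the power of X. Terms with the same power are added up.\<close>

definition poly_of :: "('g \<times> nat \<Rightarrow>\<^sub>0 'k::comm_ring_1) \<Rightarrow> 'k poly" where
  "poly_of F = (\<Sum>x\<in>keys F. monom (lookup F x) (snd x))"

lemma poly_of_superset:
  assumes "finite A" "keys F \<subseteq> A"
  shows "poly_of F = (\<Sum>x\<in>A. monom (lookup F x) (snd x))"
  unfolding poly_of_def
  by (rule sum.mono_neutral_left[OF assms]) (metis DiffD2 in_keys_iff monom_eq_0)

lemma coeff_poly_of: "coeff (poly_of F) k = (\<Sum>\<delta>\<in>fst ` keys F. lookup F (\<delta>, k))"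
proof -
  define A where "A = fst ` keys F \<times> insert k (snd ` keys F)"
  have "finite A" by (simp add: A_def)
  moreover have "keys F \<subseteq> A" by (force simp: A_def)
  ultimately have "coeff (poly_of F) k = (\<Sum>x\<in>A. if snd x = k then lookup F x else 0)"
    by (subst poly_of_superset[of A]) (simp_all add: coeff_sum)
  also have "\<dots> = (\<Sum>\<delta>\<in>fst ` keys F. \<Sum>i\<in>insert k (snd ` keys F). if i = k then lookup F (\<delta>, i) else 0)"
    unfolding A_def by (subst sum.cartesian_product) (auto intro!: sum.cong)
  also have "\<dots> = (\<Sum>\<delta>\<in>fst ` keys F. lookup F (\<delta>, k))"
    by (intro sum.cong refl) (subst sum.delta, auto)
  finally show ?thesis .
qed

text \<open>Both sides expand to the same double sum over pairs of terms, after the exponent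
  \<open>z\<close> of the product is summed out over a finite set containing all sums of
  exponents.\<close>

lemma poly_of_mult:
  fixes F G :: "'g::comm_monoid_add \<times> nat \<Rightarrow>\<^sub>0 'k::comm_ring_1"
  shows "poly_of (F * G) = poly_of F * poly_of G"
proof -
  define A where "A = (\<lambda>(x, y). x + y) ` (keys F \<times> keys G)"
  have A: "finite A" by (simp add: A_def)
  have "keys (F * G) \<subseteq> A" using keys_mult[of F G] by (force simp: A_def)
  then have "poly_of (F * G) = (\<Sum>z\<in>A. monom (lookup (F * G) z) (snd z))"
    by (rule poly_of_superset[OF A])
  also have "\<dots> = (\<Sum>z\<in>A. \<Sum>x\<in>keys F. \<Sum>y\<in>keys G.
      if x + y = z then monom (lookup F x * lookup G y) (snd z) else 0)"
    unfolding lookup_mult_keys by (intro sum.cong refl) (auto simp: monom_sum when_def intro!: sum.cong)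
  also have "\<dots> = (\<Sum>x\<in>keys F. \<Sum>y\<in>keys G. \<Sum>z\<in>A.
      if x + y = z then monom (lookup F x * lookup G y) (snd z) else 0)"
    by (subst sum.swap) (intro sum.cong refl sum.swap)
  also have "\<dots> = (\<Sum>x\<in>keys F. \<Sum>y\<in>keys G. monom (lookup F x * lookup G y) (snd (x + y)))"
    using A by (intro sum.cong refl) (subst sum.delta', auto simp: A_def)
  also have "\<dots> = poly_of F * poly_of G"
    by (simp add: poly_of_def sum_product mult_monom)
  finally show ?thesis .
qed

context graded
begin

text \<open>A right inverse of \<open>poly_of\<close> on polynomials over the homogeneous quotient
  field: every coefficient is split into its components. The finite support that
  \<open>Abs_poly_mapping\<close> presupposes is checked in \<open>lookup_hpoly\<close>.\<close>

definition hpoly :: "'k poly \<Rightarrow> 'g \<times> nat \<Rightarrow>\<^sub>0 'k" where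
  "hpoly f = Abs_poly_mapping (\<lambda>(\<delta>, i). hcomps \<Gamma> Rg (coeff f i) \<delta>)"

lemma lookup_hpoly:
  assumes "\<And>i. coeff f i \<in> RH \<Gamma> Rg R"
  shows "lookup (hpoly f) (\<delta>, i) = hcomps \<Gamma> Rg (coeff f i) \<delta>"
proof -
  have "{x. (case x of (\<delta>, i) \<Rightarrow> hcomps \<Gamma> Rg (coeff f i) \<delta>) \<noteq> 0}
      \<subseteq> (\<Union>i\<le>degree f. {\<delta>. hcomps \<Gamma> Rg (coeff f i) \<delta> \<noteq> 0} \<times> {i})"
  proof clarify
    fix \<delta> i assume nz: "hcomps \<Gamma> Rg (coeff f i) \<delta> \<noteq> 0"
    then have "coeff f i \<noteq> 0" using hcomps_zero by force
    then have "i \<le> degree f" by (rule le_degree)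
    then show "(\<delta>, i) \<in> (\<Union>i\<le>degree f. {\<delta>. hcomps \<Gamma> Rg (coeff f i) \<delta> \<noteq> 0} \<times> {i})"
      using nz by auto
  qed
  moreover have "finite (\<Union>i\<le>degree f. {\<delta>. hcomps \<Gamma> Rg (coeff f i) \<delta> \<noteq> 0} \<times> {i})"
    using RH_decomposition(1) assms by blast
  ultimately have "finite {x. (case x of (\<delta>, i) \<Rightarrow> hcomps \<Gamma> Rg (coeff f i) \<delta>) \<noteq> 0}"
    by (rule finite_subset)
  then show ?thesis by (simp add: hpoly_def)
qed

lemma lookup_hpoly_comp0:
  assumes "\<And>i. coeff f i \<in> RH \<Gamma> Rg R"
  shows "lookup (hpoly f) x \<in> comp0 (fst x)"
  using lookup_hpoly[OF assms, of "fst x" "snd x"] RH_decomposition(2)[OF assms] by simp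

lemma keys_hpoly_quot_group:
  assumes "\<And>i. coeff f i \<in> RH \<Gamma> Rg R"
  shows "keys (hpoly f) \<subseteq> quot_group \<Gamma> \<times> UNIV"
proof
  fix x assume x: "x \<in> keys (hpoly f)"
  then have "lookup (hpoly f) x \<noteq> 0" unfolding in_keys_iff .
  then have "lookup (hpoly f) x \<in> comp (fst x)"
    using lookup_hpoly_comp0[OF assms, of x] by (simp add: comp0_def)
  then show "x \<in> quot_group \<Gamma> \<times> UNIV"
    using comp_quot_group by (cases x) auto
qed

lemma poly_of_hpoly:
  assumes "\<And>i. coeff f i \<in> RH \<Gamma> Rg R"
  shows "poly_of (hpoly f) = f"
proof (rule poly_eqI)
  fix k
  have "(\<Sum>\<delta>\<in>fst ` keys (hpoly f). hcomps \<Gamma> Rg (coeff f k) \<delta>)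
      = (\<Sum>\<delta>\<in>{\<delta>. hcomps \<Gamma> Rg (coeff f k) \<delta> \<noteq> 0}. hcomps \<Gamma> Rg (coeff f k) \<delta>)"
  proof (rule sum.mono_neutral_right)
    show "{\<delta>. hcomps \<Gamma> Rg (coeff f k) \<delta> \<noteq> 0} \<subseteq> fst ` keys (hpoly f)"
    proof clarify
      fix \<delta> assume "hcomps \<Gamma> Rg (coeff f k) \<delta> \<noteq> 0"
      then have "(\<delta>, k) \<in> keys (hpoly f)" by (simp only: in_keys_iff lookup_hpoly[OF assms] simp_thms)
      then show "\<delta> \<in> fst ` keys (hpoly f)" by force
    qed
  qed auto
  then show "coeff (poly_of (hpoly f)) k = coeff f k"
    unfolding coeff_poly_of lookup_hpoly[OF assms] using RH_decomposition(3)[OF assms] by metis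
qed

lemma hcomps_poly_of:
  assumes "\<And>x. lookup H x \<in> comp0 (fst x)"
  shows "hcomps \<Gamma> Rg (coeff (poly_of H) k) \<delta> = lookup H (\<delta>, k)"
proof -
  have "hcomps \<Gamma> Rg (coeff (poly_of H) k) = (\<lambda>\<delta>. lookup H (\<delta>, k))"
  proof (rule hcomps_eqI)
    show "lookup H (\<delta>, k) \<in> comp0 \<delta>" for \<delta> using assms[of "(\<delta>, k)"] by simp
    show "lookup H (\<delta>, k) = 0" if "\<delta> \<notin> fst ` keys H" for \<delta>
      using that by (metis fst_conv image_eqI in_keys_iff)
  qed (simp_all add: coeff_poly_of)
  then show ?thesis by simp
qed

lemma hpoly_mult_comp0:
  assumes f: "\<And>i. coeff f i \<in> RH \<Gamma> Rg R" and g: "\<And>i. coeff g i \<in> RH \<Gamma> Rg R"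
  shows "lookup (hpoly f * hpoly g) z \<in> comp0 (fst z)"
  unfolding lookup_mult_keys
  using comp0_mult[OF lookup_hpoly_comp0[OF f] lookup_hpoly_comp0[OF g]]
  by (intro comp0_sum) (auto simp: when_def comp0_zero)

text \<open>The product of the two splittings respects degrees and is mapped to \<open>f * g\<close>
  by \<open>poly_of\<close>, so uniqueness of components identifies it.\<close>

lemma hcomps_mult:
  assumes f: "\<And>i. coeff f i \<in> RH \<Gamma> Rg R" and g: "\<And>i. coeff g i \<in> RH \<Gamma> Rg R"
  shows "hcomps \<Gamma> Rg (coeff (f * g) k) \<delta> = lookup (hpoly f * hpoly g) (\<delta>, k)"
  using hcomps_poly_of[OF hpoly_mult_comp0[OF f g], of k \<delta>]
  by (simp add: poly_of_mult poly_of_hpoly[OF f] poly_of_hpoly[OF g])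

lemma submod_Af:
  assumes "\<And>i. coeff f i \<in> RH \<Gamma> Rg R"
  shows "submod R (Af \<Gamma> Rg R f)"
  unfolding Af_def using compset_subset_frac[OF assms] by (intro submod_rspan) blast

lemma coeff_mem_Af:
  assumes "\<And>i. coeff f i \<in> RH \<Gamma> Rg R"
  shows "coeff f i \<in> Af \<Gamma> Rg R f"
proof -
  have "rspan R (compset \<Gamma> Rg (coeff f i)) \<subseteq> Af \<Gamma> Rg R f"
    unfolding Af_def using compset_subset_frac[OF assms] by (intro rspan_mono) blast+
  then show ?thesis using mem_rspan_compset[OF assms] by blast
qed

text \<open>Here the components of the product are controlled directly, so no membership of its
  coefficients in \<open>RH\<close> is invoked.\<close>

lemma submod_Af_mult:
  assumes f: "\<And>i. coeff f i \<in> RH \<Gamma> Rg R" and g: "\<And>i. coeff g i \<in> RH \<Gamma> Rg R"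
  shows "submod R (Af \<Gamma> Rg R (f * g))"
proof -
  have "hcomps \<Gamma> Rg (coeff (f * g) k) \<delta> \<in> frac R" for k \<delta>
    using hpoly_mult_comp0[OF f g, of "(\<delta>, k)"] comp0_subset_frac
    unfolding hcomps_mult[OF f g] by blast
  then show ?thesis
    unfolding Af_def by (intro submod_rspan) (auto simp: compset_def)
qed

lemma Af_least:
  assumes "submod R E" "\<And>i. compset \<Gamma> Rg (coeff f i) \<subseteq> E"
  shows "Af \<Gamma> Rg R f \<subseteq> E"
  unfolding Af_def using assms by (intro rspan_least) blast+

text \<open>This serves single polynomials, with \<open>F\<close> their splitting, and products,
  with \<open>F\<close> the product of two splittings. It also displays the content module as
  finitely generated.\<close>

lemma Af_eq_rspan:
  assumes "\<And>i \<delta>. hcomps \<Gamma> Rg (coeff f i) \<delta> = lookup F (\<delta>, i)"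
  shows "Af \<Gamma> Rg R f = rspan R (lookup F ` keys F)"
proof -
  have "(\<Union>i. compset \<Gamma> Rg (coeff f i)) = lookup F ` keys F"
  proof (intro equalityI subsetI)
    fix y assume "y \<in> (\<Union>i. compset \<Gamma> Rg (coeff f i))"
    then obtain i \<delta> where "y = lookup F (\<delta>, i)" "lookup F (\<delta>, i) \<noteq> 0"
      by (auto simp: compset_def assms)
    then show "y \<in> lookup F ` keys F" by (metis image_eqI in_keys_iff)
  next
    fix y assume "y \<in> lookup F ` keys F"
    then obtain \<delta> i where "(\<delta>, i) \<in> keys F" and y: "y = lookup F (\<delta>, i)" by auto
    then have "lookup F (\<delta>, i) \<noteq> 0" unfolding in_keys_iff by simp
    with y show "y \<in> (\<Union>i. compset \<Gamma> Rg (coeff f i))"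
      unfolding compset_def assms by (intro UN_I[of i] CollectI exI[of _ \<delta>] conjI) simp_all
  qed
  then show ?thesis by (simp add: Af_def)
qed

end

section \<open>Content formula and invertibility\<close>

locale graded_semistar = graded R \<Gamma> Rg + semistar_domain R star
  for R :: "'k::field set" and star :: "'k set \<Rightarrow> 'k set"
    and \<Gamma> :: "'g::ab_group_add set" and Rg :: "'g \<Rightarrow> 'k set"
begin

section \<open>From invertibility to the content formula\<close>

lemma Af_mult_subset:
  assumes f: "\<And>i. coeff f i \<in> RH \<Gamma> Rg R" and g: "\<And>i. coeff g i \<in> RH \<Gamma> Rg R"
  shows "Af \<Gamma> Rg R (f * g) \<subseteq> mprod R (Af \<Gamma> Rg R f) (Af \<Gamma> Rg R g)"
proof -
  define F G where "F = hpoly f" and "G = hpoly g"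
  have Af: "Af \<Gamma> Rg R f = rspan R (lookup F ` keys F)"
    unfolding F_def by (rule Af_eq_rspan[OF lookup_hpoly[OF f, symmetric]])
  have Ag: "Af \<Gamma> Rg R g = rspan R (lookup G ` keys G)"
    unfolding G_def by (rule Af_eq_rspan[OF lookup_hpoly[OF g, symmetric]])
  have Afg: "Af \<Gamma> Rg R (f * g) = rspan R (lookup (F * G) ` keys (F * G))"
    unfolding F_def G_def by (rule Af_eq_rspan[OF hcomps_mult[OF f g]])
  have M: "submod R (mprod R (Af \<Gamma> Rg R f) (Af \<Gamma> Rg R g))"
    using submod_Af[OF f] submod_Af[OF g] by (intro submod_mprod) (simp_all add: submod_def)
  \<comment> \<open>A component of the product is a sum of products of components of the
    factors.\<close>
  have "lookup (F * G) z \<in> mprod R (Af \<Gamma> Rg R f) (Af \<Gamma> Rg R g)" for z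
    unfolding lookup_mult_keys
  proof (intro submod_sum[OF M])
    fix x y assume "x \<in> keys F" "y \<in> keys G"
    then have "lookup F x * lookup G y \<in> mprod R (Af \<Gamma> Rg R f) (Af \<Gamma> Rg R g)"
      unfolding Af Ag by (intro mprod_mem rspan_mem imageI)
    then show "(lookup F x * lookup G y when x + y = z) \<in> mprod R (Af \<Gamma> Rg R f) (Af \<Gamma> Rg R g)"
      using M by (simp add: when_def submod_def)
  qed
  then show ?thesis unfolding Afg by (intro rspan_least[OF M]) blast
qed

text \<open>A common homogeneous denominator \<open>h\<close> turns the content module of
  \<open>f\<close> into a homogeneous ideal \<open>I\<close> of \<open>R\<close>. Invertibility of
  \<open>I\<close> gives a dense set in \<open>I\<close> times its inverse, and \<open>h\<close> is
  moved from the first factor to the second.\<close>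

lemma GPstarMD_dense_content:
  assumes GP: "GPstarMD \<Gamma> Rg R star" and f: "\<And>i. coeff f i \<in> RH \<Gamma> Rg R" and "f \<noteq> 0"
  obtains W where "dense W"
    "W \<subseteq> mprod R (Af \<Gamma> Rg R f) {v \<in> frac R. \<forall>x. v * lookup (hpoly f) x \<in> R}"
proof -
  define F where "F = hpoly f"
  have Af: "Af \<Gamma> Rg R f = rspan R (lookup F ` keys F)"
    unfolding F_def by (rule Af_eq_rspan[OF lookup_hpoly[OF f, symmetric]])
  have F_comp: "lookup F x \<in> comp (fst x)" if "x \<in> keys F" for x
    using lookup_hpoly_comp0[OF f, of x] that[unfolded in_keys_iff]
    by (simp add: F_def comp0_def)
  obtain \<beta> h where h: "\<beta> \<in> \<Gamma>" "h \<in> Rg \<beta>" "h \<noteq> 0"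
    "\<And>x. x \<in> keys F \<Longrightarrow> \<beta> + fst x \<in> \<Gamma> \<and> h * lookup F x \<in> Rg (\<beta> + fst x)"
    using common_denominator[of "keys F" "lookup F" fst] F_comp by (metis finite_keys)
  define S where "S = (\<lambda>x. h * lookup F x) ` keys F"
  define I where "I = rspan R S"
  have SH: "S \<subseteq> homog \<Gamma> Rg"
  proof
    fix s assume "s \<in> S"
    then obtain x where x: "x \<in> keys F" "s = h * lookup F x" by (auto simp: S_def)
    have "s \<noteq> 0" using x(1)[unfolded in_keys_iff] h(3) x(2) by simp
    then show "s \<in> homog \<Gamma> Rg" using h(4)[OF x(1)] x(2) homogI by blast
  qed
  then have SR: "S \<subseteq> R" "S \<subseteq> frac R" using homog_subset subset_frac by blast+
  have SI: "S \<subseteq> I" unfolding I_def using rspan_mem by blast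
  have I: "submod R I" "I \<subseteq> R"
    unfolding I_def using submod_rspan[OF SR(2)] rspan_least[OF submod_self SR(1)] by simp_all
  have IH: "I = rspan R (I \<inter> homog \<Gamma> Rg)"
  proof
    have "rspan R S \<subseteq> rspan R (I \<inter> homog \<Gamma> Rg)"
      using SI SH I(2) subset_frac by (intro rspan_mono) auto
    then show "I \<subseteq> rspan R (I \<inter> homog \<Gamma> Rg)" unfolding I_def[symmetric] .
    show "rspan R (I \<inter> homog \<Gamma> Rg) \<subseteq> I" by (rule rspan_least[OF I(1)]) blast
  qed
  have "finite S" by (simp add: S_def)
  then have "fg_homog_ideal \<Gamma> Rg R I"
    unfolding fg_homog_ideal_def using IH SR(1) I_def by blast
  moreover have "I \<noteq> {0}"
  proof -
    have "keys F \<noteq> {}"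
      using \<open>f \<noteq> 0\<close> poly_of_hpoly[OF f] by (force simp: F_def poly_of_def)
    then obtain x where "x \<in> keys F" by blast
    then have "h * lookup F x \<in> S" unfolding S_def by (rule imageI)
    moreover from this have "h * lookup F x \<noteq> 0" using SH by (auto simp: homog_def)
    ultimately show ?thesis using SI by blast
  qed
  ultimately have "star_f_invertible R star I" using GP by (simp add: GPstarMD_def)
  then have "1 \<in> tilde (mprod R I (colon R I))"
    using star_f_invertible_iff[of I] I(1) by (simp add: submod_def)
  moreover have "submod R (mprod R I (colon R I))"
    using I(1) by (intro submod_mprod colon_subset) (simp add: submod_def)
  ultimately obtain W where W: "dense W" "W \<subseteq> mprod R I (colon R I)"
    by (auto simp: mem_tilde)
  \<comment> \<open>This is the inverse of the content module of \<open>f\<close>, tested on the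
    components of the coefficients only.\<close>
  define Y where "Y = {v \<in> frac R. \<forall>x. v * lookup F x \<in> R}"
  define M where "M = mprod R (Af \<Gamma> Rg R f) Y"
  have M: "submod R M"
    unfolding M_def using submod_Af[OF f] by (intro submod_mprod) (auto simp: submod_def Y_def)
  have "p * q \<in> M" if p: "p \<in> I" and q: "q \<in> colon R I" for p q
  proof -
    have qf: "q \<in> frac R" "\<And>p. p \<in> I \<Longrightarrow> q * p \<in> R"
      using q by (auto simp: colon_def smul_def)
    \<comment> \<open>Multiplying an element of the inverse of \<open>I\<close> by \<open>h\<close>
      gives an element of \<open>Y\<close>.\<close>
    have "h * q * lookup F y \<in> R" for y
    proof (cases "y \<in> keys F")
      case True
      then have "q * (h * lookup F y) \<in> R" using qf(2) SI by (auto simp: S_def)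
      then show ?thesis by (simp add: mult_ac)
    next
      case False
      then show ?thesis using zero by (simp add: not_in_keys_iff_lookup_eq_zero)
    qed
    moreover have "h * q \<in> frac R"
      using h(1,2) Rg_subset subset_frac qf(1) by (intro frac_mult) blast+
    ultimately have hq: "h * q \<in> Y" by (simp add: Y_def)
    have "q * s \<in> M" if s: "s \<in> S" for s
    proof -
      obtain x where x: "x \<in> keys F" "s = h * lookup F x" using s unfolding S_def by blast
      have "lookup F x * (h * q) \<in> M"
        unfolding M_def Af using x(1) hq by (intro mprod_mem rspan_mem imageI)
      then show ?thesis by (simp add: x(2) mult_ac)
    qed
    then have "I \<subseteq> {v \<in> frac R. q * v \<in> M}"
      unfolding I_def using SR(2) by (intro rspan_least submod_preimage_mult M) blast
    then show ?thesis using p by (auto simp: mult.commute)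
  qed
  then have "mprod R I (colon R I) \<subseteq> M" by (rule mprod_least[OF M])
  then show ?thesis using that W unfolding M_def Y_def F_def by blast
qed

text \<open>The Dedekind-Mertens formula is used with \<open>n\<close> extra factors from the
  content of \<open>f\<close>, each matched with a factor from its inverse. The matched factors are
  then cancelled one pair at a time by dense sets.\<close>

theorem GPstarMD_imp_content:
  assumes GP: "GPstarMD \<Gamma> Rg R star"
    and f: "\<And>i. coeff f i \<in> RH \<Gamma> Rg R" and g: "\<And>i. coeff g i \<in> RH \<Gamma> Rg R"
  shows "mprod R (Af \<Gamma> Rg R f) (Af \<Gamma> Rg R g) \<subseteq> tilde (Af \<Gamma> Rg R (f * g))"
proof -
  define F G where "F = hpoly f" and "G = hpoly g"
  have Af: "Af \<Gamma> Rg R f = rspan R (lookup F ` keys F)"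
    unfolding F_def by (rule Af_eq_rspan[OF lookup_hpoly[OF f, symmetric]])
  have Ag: "Af \<Gamma> Rg R g = rspan R (lookup G ` keys G)"
    unfolding G_def by (rule Af_eq_rspan[OF lookup_hpoly[OF g, symmetric]])
  define E where "E = Af \<Gamma> Rg R (f * g)"
  have E_eq: "E = rspan R (lookup (F * G) ` keys (F * G))"
    unfolding E_def F_def G_def by (rule Af_eq_rspan[OF hcomps_mult[OF f g]])
  have Ff: "lookup F x \<in> frac R" and Gf: "lookup G x \<in> frac R" for x
    using lookup_hpoly_comp0[OF f, of x] lookup_hpoly_comp0[OF g, of x] comp0_subset_frac
    unfolding F_def G_def by blast+
  have E: "submod R E" unfolding E_def by (rule submod_Af_mult[OF f g])
  have tE: "submod R (tilde E)" by (rule submod_tilde[OF E])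
  have FGE: "lookup (F * G) z \<in> E" for z
  proof (cases "z \<in> keys (F * G)")
    case True
    then show ?thesis unfolding E_eq by (intro rspan_mem imageI)
  next
    case False
    then show ?thesis using E by (simp add: not_in_keys_iff_lookup_eq_zero submod_def)
  qed
  have prod: "lookup F k * lookup G j \<in> tilde E" for k j
  \<comment> \<open>The degenerate cases are split off: the dense set is available for nonzero
    \<open>f\<close>, and \<open>n\<close> will be one less than the number of terms of
    \<open>g\<close>.\<close>
  proof (cases "f = 0 \<or> keys G = {}")
    case True
    then have "lookup F k = 0 \<or> lookup G j = 0"
    proof
      assume "f = 0"
      then show ?thesis
        using lookup_hpoly[OF f, of "fst k" "snd k"] by (simp add: F_def hcomps_zero)
    qed (metis empty_iff in_keys_iff)
    then show ?thesis using tE by (auto simp: submod_def)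
  next
    case False
    define Y where "Y = {v \<in> frac R. \<forall>x. v * lookup F x \<in> R}"
    obtain W where W: "dense W" "W \<subseteq> mprod R (Af \<Gamma> Rg R f) Y"
      using GPstarMD_dense_content[OF GP f] False unfolding Y_def F_def by blast
    \<comment> \<open>The dense set \<open>W\<close> is spanned by products of components of
      \<open>f\<close> with elements of \<open>Y\<close>, so membership of \<open>z\<close> may be
      tested after multiplication by these.\<close>
    have cancel: "z \<in> tilde E"
      if z: "z \<in> frac R" "\<And>x v. v \<in> Y \<Longrightarrow> lookup F x * v * z \<in> tilde E" for z
    proof (rule tilde_dense[OF E z(1) W(1)])
      have "a * v \<in> {w \<in> frac R. z * w \<in> tilde E}" if a: "a \<in> Af \<Gamma> Rg R f" and v: "v \<in> Y" for a v
      proof -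
        have vf: "v \<in> frac R" using v by (simp add: Y_def)
        have "(z * v) * lookup F x \<in> tilde E" for x using z(2)[OF v, of x] by (simp add: mult_ac)
        then have "Af \<Gamma> Rg R f \<subseteq> {a \<in> frac R. (z * v) * a \<in> tilde E}"
          unfolding Af using Ff by (intro rspan_least submod_preimage_mult tE) blast
        then have "a \<in> frac R" "(z * v) * a \<in> tilde E" using a by blast+
        then show ?thesis using frac_mult[OF _ vf] by (simp add: mult_ac)
      qed
      then have "mprod R (Af \<Gamma> Rg R f) Y \<subseteq> {w \<in> frac R. z * w \<in> tilde E}"
        by (intro mprod_least submod_preimage_mult tE)
      then show "z * w \<in> tilde E" if "w \<in> W" for w using that W(2) by blast
    qed
    \<comment> \<open>Iterated cancellation: each entry of \<open>ps\<close> pairs an exponent of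
      \<open>F\<close> with an element of \<open>Y\<close>.\<close>
    have cancel_list: "z \<in> tilde E"
      if "z \<in> frac R" "\<And>ps. length ps = m \<Longrightarrow> snd ` set ps \<subseteq> Y \<Longrightarrow>
        prod_list (map (lookup F) (map fst ps)) * prod_list (map snd ps) * z \<in> tilde E" for m z
      using that
    proof (induction m arbitrary: z)
      case 0
      then show ?case using "0.prems"(2)[of "[]"] by simp
    next
      case (Suc m)
      show ?case
      proof (rule cancel[OF Suc.prems(1)])
        fix x v assume v: "v \<in> Y"
        show "lookup F x * v * z \<in> tilde E"
        proof (rule Suc.IH)
          show "lookup F x * v * z \<in> frac R"
            using v Suc.prems(1) Ff by (intro frac_mult) (auto simp: Y_def)
          fix ps :: "(('g \<times> nat) \<times> 'k) list"
          assume "length ps = m" "snd ` set ps \<subseteq> Y"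
          then show "prod_list (map (lookup F) (map fst ps)) * prod_list (map snd ps) * (lookup F x * v * z) \<in> tilde E"
            using Suc.prems(2)[of "(x, v) # ps"] v by (simp add: mult_ac)
        qed
      qed
    qed
    \<comment> \<open>The list of elements of \<open>Y\<close> may be paired with any list of
      exponents of the same length, not only with the exponents in \<open>ps\<close>.\<close>
    have YF: "prod_list vs * prod_list (map (lookup F) xs) \<in> R"
      if "length vs = length xs" "set vs \<subseteq> Y" for vs xs
      using that
    proof (induction vs xs rule: list_induct2)
      case Nil
      then show ?case using one by simp
    next
      case (Cons v vs x xs)
      then have "v * lookup F x \<in> R" by (simp add: Y_def del: split_paired_All)
      then have "(v * lookup F x) * (prod_list vs * prod_list (map (lookup F) xs)) \<in> R"
        using Cons by (intro mult[of "v * lookup F x"]) simp_all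
      then show ?case by (simp add: mult_ac)
    qed
    obtain n where n: "card (keys G) = Suc n"
      using False by (metis card_eq_0_iff finite_keys not0_implies_Suc)
    show ?thesis
    proof (rule cancel_list[of _ n])
      show "lookup F k * lookup G j \<in> frac R" by (rule frac_mult[OF Ff Gf])
      fix ps :: "(('g \<times> nat) \<times> 'k) list"
      assume ps: "length ps = n" "snd ` set ps \<subseteq> Y"
      define c where "c = prod_list (map snd ps)"
      \<comment> \<open>With \<open>k\<close> the list reaches length \<open>Suc n\<close>. The
        product \<open>c\<close> is absorbed into the target subgroup; in the premise on lists of
        length \<open>n\<close> it brings their coefficients into \<open>R\<close>.\<close>
      have "prod_list (map (lookup F) (k # map fst ps)) * lookup G j \<in> {z. c * z \<in> tilde E}"
      proof (rule dedekind_mertens[OF unique_sums_quot_group _ _ n])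
        show "keys F \<subseteq> quot_group \<Gamma> \<times> UNIV" "keys G \<subseteq> quot_group \<Gamma> \<times> UNIV"
          unfolding F_def G_def by (rule keys_hpoly_quot_group[OF f], rule keys_hpoly_quot_group[OF g])
        show "add_subgroup {z. c * z \<in> tilde E}"
          using submod_diff[OF tE] tE
          by (intro add_subgroup_preimage_mult) (simp add: add_subgroup_def submod_def)
        show "length (k # map fst ps) = Suc n" using ps(1) by simp
        fix xs :: "('g \<times> nat) list" and z :: "'g \<times> nat"
        assume "length xs = n"
        then have "c * prod_list (map (lookup F) xs) \<in> R"
          unfolding c_def using ps by (intro YF) auto
        then have "c * prod_list (map (lookup F) xs) * lookup (F * G) z \<in> E"
          using FGE E by (simp add: submod_def)
        then show "prod_list (map (lookup F) xs) * lookup (F * G) z \<in> {z. c * z \<in> tilde E}"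
          using tilde_extensive[OF E] by (auto simp: mult_ac)
      qed
      then show "prod_list (map (lookup F) (map fst ps)) * prod_list (map snd ps) * (lookup F k * lookup G j) \<in> tilde E"
        by (simp add: c_def mult_ac)
    qed
  qed
  have "x * y \<in> tilde E" if x: "x \<in> Af \<Gamma> Rg R f" and y: "y \<in> Af \<Gamma> Rg R g" for x y
  proof -
    have "Af \<Gamma> Rg R g \<subseteq> {v \<in> frac R. lookup F k * v \<in> tilde E}" for k
      unfolding Ag using prod Gf by (intro rspan_least submod_preimage_mult tE) blast
    then have "y \<in> frac R" "lookup F k * y \<in> tilde E" for k using y by blast+
    then have "Af \<Gamma> Rg R f \<subseteq> {v \<in> frac R. y * v \<in> tilde E}"
      unfolding Af using Ff by (intro rspan_least submod_preimage_mult tE) (auto simp: mult.commute)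
    then show ?thesis using x by (auto simp: mult.commute)
  qed
  then show ?thesis unfolding E_def[symmetric] by (rule mprod_least[OF tE])
qed

text \<open>The premises \<open>Ma\<close> and \<open>Mb\<close> make \<open>M\<close> contain all
  \<open>r\<close> in \<open>R\<close> with \<open>r * a\<close> in \<open>b\<close> times
  \<open>R\<close>, or \<open>r * b\<close> in \<open>a\<close> times \<open>R\<close>. These
  generate the product of the ideal of \<open>a\<close> and \<open>b\<close> with its inverse; a
  general \<open>M\<close> is kept for the induction on generators.\<close>

lemma content_imp_two_generated:
  assumes content: "\<And>f g. (\<And>i. coeff f i \<in> RH \<Gamma> Rg R) \<Longrightarrow> (\<And>i. coeff g i \<in> RH \<Gamma> Rg R) \<Longrightarrow>
      mprod R (Af \<Gamma> Rg R f) (Af \<Gamma> Rg R g) \<subseteq> tilde (Af \<Gamma> Rg R (f * g))"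
    and a: "a \<in> homog \<Gamma> Rg" and b: "b \<in> homog \<Gamma> Rg" and M: "submod R M"
    and Ma: "\<And>r s. r \<in> R \<Longrightarrow> s \<in> R \<Longrightarrow> r * a = s * b \<Longrightarrow> r \<in> M"
    and Mb: "\<And>r s. r \<in> R \<Longrightarrow> s \<in> R \<Longrightarrow> r * b = s * a \<Longrightarrow> r \<in> M"
  shows "1 \<in> tilde M"
proof -
  have aR: "a \<in> R" "a \<noteq> 0" and bR: "b \<in> R"
    using a b homog_subset by (auto simp: homog_def)
  have RRH: "x \<in> RH \<Gamma> Rg R" if "x \<in> R" for x using that ring_subset_RH by blast
  have RH0: "0 \<in> RH \<Gamma> Rg R" and RH1: "1 \<in> RH \<Gamma> Rg R" using RRH zero one by blast+
  \<comment> \<open>The ideal generated by the two squares, with explicit coefficients so that they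
    can be extracted later.\<close>
  define Z where "Z = {x * (a * a) + y * (b * b) | x y. x \<in> R \<and> y \<in> R}"
  have Zmem: "x * (a * a) + y * (b * b) \<in> Z" if "x \<in> R" "y \<in> R" for x y
    unfolding Z_def using that by blast
  have Z: "submod R Z"
    unfolding submod_def
  proof (intro conjI ballI)
    have "x * (a * a) + y * (b * b) \<in> R" if "x \<in> R" "y \<in> R" for x y
      by (intro add mult aR(1) bR that)
    then show "Z \<subseteq> frac R" unfolding Z_def using subset_frac by blast
    show "0 \<in> Z" using Zmem[OF zero zero] by simp
    show "p + q \<in> Z" if p: "p \<in> Z" and q: "q \<in> Z" for p q
    proof -
      obtain x y where p': "p = x * (a * a) + y * (b * b)" "x \<in> R" "y \<in> R" using p unfolding Z_def by blast
      obtain x' y' where q': "q = x' * (a * a) + y' * (b * b)" "x' \<in> R" "y' \<in> R" using q unfolding Z_def by blast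
      have "p + q = (x + x') * (a * a) + (y + y') * (b * b)" by (simp add: p' q' algebra_simps)
      then show ?thesis using Zmem[OF add[OF p'(2) q'(2)] add[OF p'(3) q'(3)]] by simp
    qed
    show "r * p \<in> Z" if r: "r \<in> R" and p: "p \<in> Z" for r p
    proof -
      obtain x y where p': "p = x * (a * a) + y * (b * b)" "x \<in> R" "y \<in> R" using p unfolding Z_def by blast
      have "r * p = (r * x) * (a * a) + (r * y) * (b * b)" by (simp add: p' algebra_simps)
      then show ?thesis using Zmem[OF mult[OF r p'(2)] mult[OF r p'(3)]] by simp
    qed
  qed
  \<comment> \<open>The middle term of the product cancels, so its content involves the squares
    only, whereas \<open>a * - b\<close> is a product of coefficients of the factors.\<close>
  define f g where "f = [:a, b:]" and "g = [:a, - b:]"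
  have f: "coeff f i \<in> RH \<Gamma> Rg R" and g: "coeff g i \<in> RH \<Gamma> Rg R" for i
    using RRH[OF aR(1)] RRH[OF bR] RRH[OF uminus[OF bR]] RH0
    by (simp_all add: f_def g_def coeff_pCons split: nat.split)
  have fg: "f * g = [:a * a, 0, - (b * b):]" by (simp add: f_def g_def)
  have Zc: "a * a \<in> Z" "- (b * b) \<in> Z"
    using Zmem[OF one zero] Zmem[OF zero uminus[OF one]] by simp_all
  have "a * a \<in> homog \<Gamma> Rg" by (rule homog_mult[OF a a])
  moreover have "- (b * b) \<in> homog \<Gamma> Rg"
    using homog_uminus[OF homog_mult[OF b b]] .
  ultimately have "compset \<Gamma> Rg (a * a) \<subseteq> Z" "compset \<Gamma> Rg (- (b * b)) \<subseteq> Z"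
    using Zc by (simp_all add: compset_homog)
  then have "Af \<Gamma> Rg R (f * g) \<subseteq> Z"
    by (intro Af_least[OF Z]) (simp add: fg coeff_pCons compset_zero split: nat.split)
  moreover have sub_fg: "submod R (Af \<Gamma> Rg R (f * g))"
    by (rule submod_Af_mult[OF f g])
  moreover have "a * - b \<in> tilde (Af \<Gamma> Rg R (f * g))"
    using content[OF f g] mprod_mem[OF coeff_mem_Af[OF f, of 0] coeff_mem_Af[OF g, of 1]]
    by (simp add: f_def g_def subset_iff)
  ultimately obtain D where D: "dense D" "\<And>d. d \<in> D \<Longrightarrow> (a * - b) * d \<in> Z"
    unfolding mem_tilde[OF sub_fg] by blast
  \<comment> \<open>By \<open>tilde_dense\<close> with \<open>z = 1\<close> it suffices to bring
    every element of the dense set \<open>D\<close> into the closure.\<close>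
  have "1 * t \<in> tilde M" if t: "t \<in> D" for t
  proof -
    have tR: "t \<in> R" using D(1) t by (auto simp: dense_def)
    obtain x' y' where xy': "(a * - b) * t = x' * (a * a) + y' * (b * b)" "x' \<in> R" "y' \<in> R"
      using D(2)[OF t] unfolding Z_def by blast
    define x y where "x = - x'" and "y = - y'"
    have xR: "x \<in> R" and yR: "y \<in> R" using xy' uminus by (simp_all add: x_def y_def)
    have "x * (a * a) + y * (b * b) = - ((a * - b) * t)"
      unfolding xy'(1) by (simp add: x_def y_def)
    then have tab: "t * (a * b) = x * (a * a) + y * (b * b)" by (simp add: mult_ac)
    \<comment> \<open>Dividing \<open>tab\<close> by \<open>a * b\<close> writes \<open>t\<close> as
      the sum of \<open>x * a / b\<close> and \<open>y * b / a\<close>. The second summand is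
      \<open>u\<close>, the first is \<open>t - u\<close>, and their product is
      \<open>x * y\<close>.\<close>
    define u where "u = y * b / a"
    have ua: "u * a = y * b" using aR(2) by (simp add: u_def)
    have "u * (t - u) * (a * a) = (u * a) * (t * a) - (u * a) * (u * a)" by (simp add: algebra_simps)
    also have "\<dots> = y * (t * (a * b)) - y * b * (y * b)" unfolding ua by (simp add: mult_ac)
    also have "\<dots> = (x * y) * (a * a)" unfolding tab by (simp add: algebra_simps)
    finally have utu: "u * (t - u) = x * y" using aR(2) by simp
    have u_RH: "u \<in> RH \<Gamma> Rg R"
      unfolding RH_def u_def using mult[OF yR bR] a by blast
    \<comment> \<open>A monic product with coefficients in \<open>R\<close> whose roots
      \<open>u\<close> and \<open>t - u\<close> need not lie in \<open>R\<close>; the content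
      formula puts \<open>u\<close> into the closure of \<open>R\<close>.\<close>
    define f' g' where "f' = [:- u, 1:]" and "g' = [:u - t, 1:]"
    have f': "coeff f' i \<in> RH \<Gamma> Rg R" and g': "coeff g' i \<in> RH \<Gamma> Rg R" for i
      using RH_diff[OF u_RH RRH[OF tR]] RH_diff[OF RH0 u_RH] RH0 RH1
      by (simp_all add: f'_def g'_def coeff_pCons split: nat.split)
    have fg': "f' * g' = [:x * y, - t, 1:]"
      unfolding utu[symmetric] by (simp add: f'_def g'_def algebra_simps)
    have coeff_fg': "coeff (f' * g') i \<in> R" for i
      using mult[OF xR yR] uminus[OF tR] one zero by (simp add: fg' coeff_pCons split: nat.split)
    have "Af \<Gamma> Rg R (f' * g') \<subseteq> R"
      by (intro Af_least submod_self compset_subset_ring coeff_fg')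
    moreover have "submod R (Af \<Gamma> Rg R (f' * g'))" by (intro submod_Af RRH coeff_fg')
    moreover have "- u * 1 \<in> tilde (Af \<Gamma> Rg R (f' * g'))"
      using content[OF f' g'] mprod_mem[OF coeff_mem_Af[OF f', of 0] coeff_mem_Af[OF g', of 1]]
      by (simp add: f'_def g'_def subset_iff)
    ultimately have "- u * 1 \<in> tilde R" using tilde_mono[OF _ submod_self] by blast
    then have "- u \<in> tilde R" by simp
    then obtain D' where D': "dense D'" "\<And>d. d \<in> D' \<Longrightarrow> - u * d \<in> R"
      unfolding mem_tilde[OF submod_self] by blast
    \<comment> \<open>The element splits as \<open>u * s\<close> plus \<open>(t - u) * s\<close>:
      the first summand falls under \<open>Ma\<close>, the second under \<open>Mb\<close>.\<close>
    have "t * s \<in> M" if s: "s \<in> D'" for s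
    proof -
      have sR: "s \<in> R" using D'(1) s by (auto simp: dense_def)
      have usR: "u * s \<in> R" using uminus[OF D'(2)[OF s]] by simp
      have "u * s * a = (u * a) * s" by (simp add: mult_ac)
      then have "u * s * a = (s * y) * b" unfolding ua by (simp add: mult_ac)
      then have 1: "u * s \<in> M" by (rule Ma[OF usR mult[OF sR yR]])
      have "(t * s - u * s) * b * a = s * (t * (a * b)) - s * b * (u * a)"
        by (simp add: algebra_simps)
      also have "\<dots> = (s * x) * a * a" unfolding tab ua by (simp add: algebra_simps)
      finally have "(t * s - u * s) * b = (s * x) * a" using aR(2) by simp
      then have 2: "t * s - u * s \<in> M"
        by (rule Mb[OF diff[OF mult[OF tR sR] usR] mult[OF sR xR]])
      have "u * s + (t * s - u * s) \<in> M" using M 1 2 unfolding submod_def by blast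
      then show ?thesis by simp
    qed
    moreover have "t \<in> frac R" using tR subset_frac by blast
    ultimately have "t \<in> tilde M" using D'(1) mem_tilde[OF M] by blast
    then show ?thesis by simp
  qed
  then show ?thesis by (rule tilde_dense[OF M subsetD[OF subset_frac one] D(1)])
qed

text \<open>The last premise concerns those \<open>r\<close> for which one generator
  \<open>a\<close> divides \<open>r * c\<close> for every generator \<open>c\<close>. When
  \<open>b\<close> is added, the two-generator case for \<open>a\<close> and \<open>b\<close> gives
  multipliers after which either \<open>b\<close> or \<open>a\<close> divides everything.\<close>

lemma content_imp_finitely_generated:
  assumes content: "\<And>f g. (\<And>i. coeff f i \<in> RH \<Gamma> Rg R) \<Longrightarrow> (\<And>i. coeff g i \<in> RH \<Gamma> Rg R) \<Longrightarrow>
      mprod R (Af \<Gamma> Rg R f) (Af \<Gamma> Rg R g) \<subseteq> tilde (Af \<Gamma> Rg R (f * g))"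
    and "finite S" "S \<noteq> {}" "S \<subseteq> homog \<Gamma> Rg" "submod R M"
    and "\<And>r a. r \<in> R \<Longrightarrow> a \<in> S \<Longrightarrow> (\<And>c. c \<in> S \<Longrightarrow> \<exists>s\<in>R. r * c = s * a) \<Longrightarrow> r \<in> M"
  shows "1 \<in> tilde M"
  using assms(2-)
proof (induction S arbitrary: M rule: finite_ne_induct)
  case (singleton a)
  then have "1 \<in> M" using one by blast
  then show ?case using tilde_extensive singleton.prems(2) by blast
next
  case (insert b S)
  have M: "submod R M" by fact
  \<comment> \<open>The induction hypothesis is applied to the closure, since the multipliers bring
    \<open>r\<close> only into \<open>tilde M\<close>; idempotence removes the extra
    closure.\<close>
  have "1 \<in> tilde (tilde M)"
  proof (rule insert.IH)
    show "S \<subseteq> homog \<Gamma> Rg" using insert.prems(1) by blast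
    show "submod R (tilde M)" by (rule submod_tilde[OF M])
    fix r a
    assume r: "r \<in> R" and a: "a \<in> S" and div: "\<And>c. c \<in> S \<Longrightarrow> \<exists>s\<in>R. r * c = s * a"
    have rf: "r \<in> frac R" using r subset_frac by blast
    show "r \<in> tilde M"
    proof (rule tilde_unit_preimage[OF M rf])
      show "1 \<in> tilde {v \<in> frac R. r * v \<in> M}"
      proof (rule content_imp_two_generated[OF content])
        show "a \<in> homog \<Gamma> Rg" "b \<in> homog \<Gamma> Rg" using insert.prems(1) a by blast+
        show "submod R {v \<in> frac R. r * v \<in> M}" by (rule submod_preimage_mult[OF M])
        \<comment> \<open>Here \<open>b\<close> becomes the common divisor: \<open>a\<close> divides
          each \<open>r * c\<close> with \<open>c\<close> in \<open>S\<close>, and \<open>b\<close>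
          divides \<open>v * a\<close>.\<close>
        show "v \<in> {v \<in> frac R. r * v \<in> M}" if v: "v \<in> R" and s: "s \<in> R" and eq: "v * a = s * b" for v s
        proof -
          have "r * v \<in> M"
          proof (rule insert.prems(3))
            show "r * v \<in> R" by (rule mult[OF r v])
            show "b \<in> insert b S" by blast
            fix c assume "c \<in> insert b S"
            then show "\<exists>s\<in>R. r * v * c = s * b"
            proof
              assume "c = b"
              then show ?thesis using mult[OF r v] by blast
            next
              assume "c \<in> S"
              then obtain q where q: "q \<in> R" "r * c = q * a" using div by blast
              have "r * v * c = (r * c) * v" by (simp add: mult_ac)
              also have "\<dots> = q * (v * a)" unfolding q(2) by (simp add: mult_ac)
              also have "\<dots> = (q * s) * b" unfolding eq by (simp add: mult_ac)
              finally show ?thesis using mult[OF q(1) s] by blast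
            qed
          qed
          then show ?thesis using v subset_frac by blast
        qed
        \<comment> \<open>Here \<open>a\<close> stays the common divisor and now also divides
          \<open>r * v * b\<close>.\<close>
        show "v \<in> {v \<in> frac R. r * v \<in> M}" if v: "v \<in> R" and s: "s \<in> R" and eq: "v * b = s * a" for v s
        proof -
          have "r * v \<in> M"
          proof (rule insert.prems(3))
            show "r * v \<in> R" by (rule mult[OF r v])
            show "a \<in> insert b S" using a by blast
            fix c assume "c \<in> insert b S"
            then show "\<exists>s\<in>R. r * v * c = s * a"
            proof
              assume c: "c = b"
              have "r * v * c = (r * s) * a" using eq by (simp add: c mult.assoc)
              then show ?thesis using mult[OF r s] by blast
            next
              assume "c \<in> S"
              then obtain q where q: "q \<in> R" "r * c = q * a" using div by blast
              have "r * v * c = (r * c) * v" by (simp add: mult_ac)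
              also have "\<dots> = (q * v) * a" unfolding q(2) by (simp add: mult_ac)
              finally show ?thesis using mult[OF q(1) v] by blast
            qed
          qed
          then show ?thesis using v subset_frac by blast
        qed
      qed
    qed
  qed
  then show ?case by (simp add: tilde_idem[OF M])
qed

text \<open>Each of the finitely many generators is a combination of finitely many homogeneous
  elements of \<open>I\<close>; collecting these gives a finite homogeneous generating set.\<close>

lemma fg_homog_ideal_generators:
  assumes "fg_homog_ideal \<Gamma> Rg R I"
  obtains S where "finite S" "S \<subseteq> homog \<Gamma> Rg" "I = rspan R S"
proof -
  obtain G where G: "finite G" "G \<subseteq> R" "I = rspan R G" and IH: "I = rspan R (I \<inter> homog \<Gamma> Rg)"
    using assms unfolding fg_homog_ideal_def by blast
  have "G \<subseteq> frac R" using G(2) subset_frac by blast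
  then have I: "submod R I" unfolding G(3) by (rule submod_rspan)
  have "\<exists>F. finite F \<and> F \<subseteq> I \<inter> homog \<Gamma> Rg \<and> x \<in> rspan R F" if x: "x \<in> G" for x
  proof -
    have "x \<in> I" unfolding G(3) by (rule rspan_mem[OF x])
    then have "x \<in> rspan R (I \<inter> homog \<Gamma> Rg)" using IH by simp
    then obtain F r where F: "finite F" "F \<subseteq> I \<inter> homog \<Gamma> Rg" "\<forall>s\<in>F. r s \<in> R" "x = (\<Sum>s\<in>F. r s * s)"
      unfolding rspan_def by blast
    then have "x \<in> rspan R F" unfolding rspan_def by blast
    then show ?thesis using F by blast
  qed
  then obtain F where F: "\<And>x. x \<in> G \<Longrightarrow> finite (F x) \<and> F x \<subseteq> I \<inter> homog \<Gamma> Rg \<and> x \<in> rspan R (F x)"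
    by metis
  define S where "S = (\<Union>x\<in>G. F x)"
  have S: "finite S" "S \<subseteq> I" "S \<subseteq> homog \<Gamma> Rg" using F G(1) by (auto simp: S_def)
  have Sf: "S \<subseteq> frac R" using S(3) homog_subset subset_frac by blast
  have "G \<subseteq> rspan R S"
  proof
    fix x assume x: "x \<in> G"
    then have "rspan R (F x) \<subseteq> rspan R S" by (intro rspan_mono Sf) (auto simp: S_def)
    then show "x \<in> rspan R S" using F[OF x] by blast
  qed
  then have "I \<subseteq> rspan R S" unfolding G(3) by (rule rspan_least[OF submod_rspan[OF Sf]])
  moreover have "rspan R S \<subseteq> I" by (rule rspan_least[OF I S(2)])
  ultimately show ?thesis using that S(1,3) by blast
qed

text \<open>If \<open>a\<close> divides \<open>r * c\<close> for every generator \<open>c\<close>,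
  then \<open>r / a\<close> lies in the inverse of \<open>I\<close>, so
  \<open>r = a * (r / a)\<close> lies in \<open>I\<close> times its inverse.\<close>

theorem content_imp_GPstarMD:
  assumes content: "\<And>f g. (\<And>i. coeff f i \<in> RH \<Gamma> Rg R) \<Longrightarrow> (\<And>i. coeff g i \<in> RH \<Gamma> Rg R) \<Longrightarrow>
      mprod R (Af \<Gamma> Rg R f) (Af \<Gamma> Rg R g) \<subseteq> tilde (Af \<Gamma> Rg R (f * g))"
  shows "GPstarMD \<Gamma> Rg R star"
  unfolding GPstarMD_def
proof (intro allI impI, elim conjE)
  fix I assume "fg_homog_ideal \<Gamma> Rg R I" and nz: "I \<noteq> {0}"
  then obtain S where S: "finite S" "S \<subseteq> homog \<Gamma> Rg" and I: "I = rspan R S"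
    using fg_homog_ideal_generators by metis
  have Sf: "S \<subseteq> frac R" using S(2) homog_subset subset_frac by blast
  then have If: "I \<subseteq> frac R" using submod_rspan[OF Sf] by (simp add: I submod_def)
  have "S \<noteq> {}" using rspan_nonzero[OF Sf] nz I by blast
  have "1 \<in> tilde (mprod R I (colon R I))"
  proof (rule content_imp_finitely_generated[OF content S(1) \<open>S \<noteq> {}\<close> S(2)])
    show "submod R (mprod R I (colon R I))" by (intro submod_mprod If colon_subset)
    fix r a assume r: "r \<in> R" and a: "a \<in> S" and div: "\<And>c. c \<in> S \<Longrightarrow> \<exists>s\<in>R. r * c = s * a"
    have a0: "a \<noteq> 0" using a S(2) by (auto simp: homog_def)
    have raf: "r / a \<in> frac R" using r a Sf subset_frac by (intro frac_divide) blast+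
    have "r / a * c \<in> R" if c: "c \<in> S" for c
    proof -
      obtain s where "s \<in> R" "r * c = s * a" using div[OF c] by blast
      then show ?thesis using a0 by simp
    qed
    then have "I \<subseteq> {v \<in> frac R. r / a * v \<in> R}"
      unfolding I using Sf by (intro rspan_least submod_preimage_mult submod_self) blast
    then have "r / a \<in> colon R I" using raf by (auto simp: colon_def smul_def)
    moreover have "a \<in> I" unfolding I by (rule rspan_mem[OF a])
    ultimately have "a * (r / a) \<in> mprod R I (colon R I)" by (intro mprod_mem)
    then show "r \<in> mprod R I (colon R I)" using a0 by simp
  qed
  then show "star_f_invertible R star I" using star_f_invertible_iff[OF If] by blast
qed

end

theorem theorem3p2:
  fixes \<Gamma> :: "'g::ab_group_add set" and Rg :: "'g \<Rightarrow> 'k::field set"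
    and R :: "'k set" and star :: "'k set \<Rightarrow> 'k set"
  assumes "graded_domain \<Gamma> Rg R"
    and "semistar R star"
    and "star R \<subset> RH \<Gamma> Rg R"
  shows "GPstarMD \<Gamma> Rg R star \<longleftrightarrow>
    (\<forall>f g. (\<forall>i. coeff f i \<in> RH \<Gamma> Rg R) \<and> (\<forall>i. coeff g i \<in> RH \<Gamma> Rg R) \<longrightarrow>
       star_tilde R star (mprod R (Af \<Gamma> Rg R f) (Af \<Gamma> Rg R g))
       = star_tilde R star (Af \<Gamma> Rg R (f * g)))"
proof -
  interpret graded_semistar R star \<Gamma> Rg
    using assms(1,2) by unfold_locales (auto simp: graded_domain_def)
  \<comment> \<open>The content module of \<open>f * g\<close> always lies in the product of the
    content modules, so equality of closures amounts to one inclusion.\<close>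
  have iff: "tilde (mprod R (Af \<Gamma> Rg R f) (Af \<Gamma> Rg R g)) = tilde (Af \<Gamma> Rg R (f * g)) \<longleftrightarrow>
      mprod R (Af \<Gamma> Rg R f) (Af \<Gamma> Rg R g) \<subseteq> tilde (Af \<Gamma> Rg R (f * g))"
    if f: "\<And>i. coeff f i \<in> RH \<Gamma> Rg R" and g: "\<And>i. coeff g i \<in> RH \<Gamma> Rg R" for f g
  proof -
    have M: "submod R (mprod R (Af \<Gamma> Rg R f) (Af \<Gamma> Rg R g))"
      using submod_Af[OF f] submod_Af[OF g] by (intro submod_mprod) (simp_all add: submod_def)
    have E: "submod R (Af \<Gamma> Rg R (f * g))" by (rule submod_Af_mult[OF f g])
    show ?thesis
      using tilde_extensive[OF M] tilde_subset_tilde[OF M E] tilde_mono[OF E M Af_mult_subset[OF f g]]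
      by blast
  qed
  show ?thesis
  proof (intro iffI allI impI, elim conjE)
    fix f g
    assume "GPstarMD \<Gamma> Rg R star" "\<forall>i. coeff f i \<in> RH \<Gamma> Rg R" "\<forall>i. coeff g i \<in> RH \<Gamma> Rg R"
    then show "tilde (mprod R (Af \<Gamma> Rg R f) (Af \<Gamma> Rg R g)) = tilde (Af \<Gamma> Rg R (f * g))"
      using iff[of f g] GPstarMD_imp_content[of f g] by simp
  next
    assume content: "\<forall>f g. (\<forall>i. coeff f i \<in> RH \<Gamma> Rg R) \<and> (\<forall>i. coeff g i \<in> RH \<Gamma> Rg R) \<longrightarrow>
      tilde (mprod R (Af \<Gamma> Rg R f) (Af \<Gamma> Rg R g)) = tilde (Af \<Gamma> Rg R (f * g))"
    show "GPstarMD \<Gamma> Rg R star"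
    proof (rule content_imp_GPstarMD)
      fix f g
      assume "\<And>i. coeff f i \<in> RH \<Gamma> Rg R" "\<And>i. coeff g i \<in> RH \<Gamma> Rg R"
      then show "mprod R (Af \<Gamma> Rg R f) (Af \<Gamma> Rg R g) \<subseteq> tilde (Af \<Gamma> Rg R (f * g))"
        using iff[of f g] content by simp
    qed
  qed
qed

end
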